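(* Let $n \geq 5$. Then $\tilde{H}_i(\mathcal{VR}(\mathbb{I}_n;3);\mathbb{Z}) \neq 0$ if and only if $i \in \{4,7\}$.
   Context: For $n\ge 1$, $\mathbb{I}_n$ is the $n$-dimensional hypercube graph: its vertex set is $\{0,1\}^n$ and two vertices are adjacent iff they differ in exactly one coordinate. It is regarded as a metric space with the shortest-path distance, which equals the Hamming distance $d(v,w)=\#\{i : v(i)\neq w(i)\}$, where $v(i)$ denotes the $i$-th coordinate of $v$. For a metric space $(X,d)$ and $r\ge 0$, the Vietoris–Rips complex $\mathcal{VR}(X;r)$ is the simplicial complex on vertex set $X$ whose simplices are the finite subsets $\sigma\subseteq X$ with $d(x,y)\le r$ for all $x,y\in\sigma$. $\tilde H_i$ denotes reduced simplicial homology. *)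

theory Defs
  imports "HOL-Algebra.Algebra" "HOL-Library.List_Lexorder"
begin

text \<open>Vietoris-Rips complex of a metric space (V,dist) at scale r. We include the
  empty simplex; it plays the role of the (-1)-dimensional simplex of the
  augmented chain complex, whose homology is reduced homology.\<close>
definition vr_complex :: "'a set \<Rightarrow> ('a \<Rightarrow> 'a \<Rightarrow> real) \<Rightarrow> real \<Rightarrow> 'a set set" where
  "vr_complex V dst rad = {S. S \<subseteq> V \<and> finite S \<and> (\<forall>x\<in>S. \<forall>y\<in>S. dst x y \<le> rad)}"

definition simplices_of_dim :: "'a set set \<Rightarrow> int \<Rightarrow> 'a set set" where
  "simplices_of_dim K i = {S\<in>K. int (card S) = i + 1}"

text \<open>Augmented simplicial chain group C_i(K;Z): integer-valued functions supported on
  the i-simplices (K finite), with pointwise addition.\<close>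
definition chain_group :: "'a set set \<Rightarrow> int \<Rightarrow> ('a set \<Rightarrow> int) monoid" where
  "chain_group K i = \<lparr>carrier = {c. \<forall>S. c S \<noteq> 0 \<longrightarrow> S \<in> simplices_of_dim K i},
                      monoid.mult = (\<lambda>c c' S. c S + c' S), monoid.one = (\<lambda>S. 0)\<rparr>"

text \<open>Simplicial boundary, orienting simplices by the linear order on vertices:
  the coefficient of tau in the boundary of insert v tau (v not in tau) is
  (-1)^(position of v in the sorted vertex list).\<close>
definition boundary :: "'a::linorder set set \<Rightarrow> ('a set \<Rightarrow> int) \<Rightarrow> ('a set \<Rightarrow> int)" where
  "boundary K c = (\<lambda>T. if T \<in> K then
      (\<Sum>v\<in>{v. v \<notin> T \<and> insert v T \<in> K}. (-1) ^ card {w\<in>T. w < v} * c (insert v T))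
    else 0)"

definition cycles :: "'a::linorder set set \<Rightarrow> int \<Rightarrow> ('a set \<Rightarrow> int) set" where
  "cycles K i = {c \<in> carrier (chain_group K i). boundary K c = (\<lambda>S. 0)}"

definition boundaries :: "'a::linorder set set \<Rightarrow> int \<Rightarrow> ('a set \<Rightarrow> int) set" where
  "boundaries K i = boundary K ` carrier (chain_group K (i + 1))"

definition reduced_homology :: "'a::linorder set set \<Rightarrow> int \<Rightarrow> ('a set \<Rightarrow> int) set monoid" where
  "reduced_homology K i = ((chain_group K i)\<lparr>carrier := cycles K i\<rparr>) Mod (boundaries K i)"

text \<open>Hypercube graph I_n: vertices {0,1}^n as boolean lists of length n,
  with Hamming distance (= shortest path distance).\<close>
definition hypercube :: "nat \<Rightarrow> bool list set" where
  "hypercube n = {v. length v = n}"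

definition hamming :: "bool list \<Rightarrow> bool list \<Rightarrow> real" where
  "hamming v w = real (card {i. i < length v \<and> v ! i \<noteq> w ! i})"

end

theory Submission
  imports Defs
begin

text \<open>
  Identify the vertices of the cube with subsets of {0..<n}, so that the distance is the size of
  the symmetric difference. The complex is assembled from the empty one by adding cells in
  an order in which almost all of them come in pairs consisting of a cell and a free face;
  such a pair does not change the homology (discrete Morse theory). A family in which
  membership is unaffected by inserting or deleting one fixed vertex consists of such
  pairs, and families may be treated fibrewise along any monotone map.

  The cliques that vary in at least five directions cancel completely: fix the vertices of even
  size; the clique is then, up to the symmetry of the cube, a star, a tetrahedron (the even half of
  a 3-cube) or a point, and in each case some vertex of the opposite parity can be toggled.
  The other cliques span a face of dimension at most four. Faces are paired along the
  direction k = Min U, where U is the union of the clique. A pair of faces of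
  dimensions below (3, 4) cancels, a pair of dimensions (3, 4) leaves one cell of dimension 7,
  and an unpaired 4-face, whose cliques form the boundary of a cross-polytope relative to the
  non-spanning ones, leaves one cell of dimension 4 and one of dimension 7. As 4 and 7 are
  neither equal nor adjacent, the remaining cells all survive in homology.
\<close>

section \<open>Homology of a complex built from free pairs and single cells\<close>

text \<open>New cells must not lie below old ones, so that every stage of a down-closed family
  is down-closed. The set collects the cardinalities (dimension plus one) of the unpaired cells.\<close>

inductive tower :: "nat set \<Rightarrow> 'a set set \<Rightarrow> bool" where
  empty: "tower {} {}"
| pair: "tower C F \<Longrightarrow> T \<notin> F \<Longrightarrow> v \<notin> T \<Longrightarrow> insert v T \<notin> F \<Longrightarrow> (\<forall>Y\<in>F. \<not> T \<subseteq> Y)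
    \<Longrightarrow> tower C (insert T (insert (insert v T) F))"
| crit: "tower C F \<Longrightarrow> T \<notin> F \<Longrightarrow> (\<forall>Y\<in>F. \<not> T \<subseteq> Y) \<Longrightarrow> tower (insert (card T) C) (insert T F)"

definition schains :: "'a set set \<Rightarrow> int \<Rightarrow> ('a set \<Rightarrow> int) set" where
  "schains K i = {c. \<forall>S. c S \<noteq> 0 \<longrightarrow> S \<in> K \<and> int (card S) = i + 1}"

definition sg :: "'a::linorder set \<Rightarrow> 'a \<Rightarrow> int" where
  "sg T v = (-1) ^ card {w\<in>T. w < v}"

definition bdry :: "'a::linorder set \<Rightarrow> ('a set \<Rightarrow> int) \<Rightarrow> 'a set \<Rightarrow> int" where
  "bdry V c T = (\<Sum>v\<in>V - T. sg T v * c (insert v T))"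

lemma carrier_chain_group: "carrier (chain_group K i) = schains K i"
  by (simp add: chain_group_def schains_def simplices_of_dim_def)

lemma schainsD: "c \<in> schains K i \<Longrightarrow> c S \<noteq> 0 \<Longrightarrow> S \<in> K"
  "c \<in> schains K i \<Longrightarrow> c S \<noteq> 0 \<Longrightarrow> int (card S) = i + 1"
  unfolding schains_def by blast+

lemma sg_square: "sg T v * sg T v = 1"
  by (cases "even (card {w\<in>T. w < v})") (simp_all add: sg_def)

lemma sg_insert:
  assumes "finite T" "v \<notin> T"
  shows "sg (insert v T) u = (if v < u then - sg T u else sg T u)"
proof -
  have "{w \<in> insert v T. w < u} = (if v < u then insert v {w\<in>T. w < u} else {w\<in>T. w < u})"
    by auto
  then show ?thesis using assms by (auto simp: sg_def)
qed

lemma bdry_bdry: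
  assumes V: "finite V" and c: "\<And>S. c S \<noteq> 0 \<Longrightarrow> S \<subseteq> V"
  shows "bdry V (bdry V c) T = 0"
proof (cases "T \<subseteq> V")
  case False
  then have "c (insert u (insert v T)) = 0" for u v using c by blast
  then show ?thesis by (simp add: bdry_def)
next
  case True
  then have fT: "finite T" using V finite_subset by blast
  define g where "g v u = (if u = v then 0 else sg T v * sg (insert v T) u * c (insert u (insert v T)))" for v u
  have "bdry V (bdry V c) T = (\<Sum>v\<in>V-T. \<Sum>u\<in>V - insert v T. g v u)"
    unfolding bdry_def sum_distrib_left g_def by (intro sum.cong) (auto simp: algebra_simps)
  also have "\<dots> = (\<Sum>v\<in>V-T. \<Sum>u\<in>V-T. g v u)"
    by (intro sum.cong sum.mono_neutral_left) (use V in \<open>auto simp: g_def\<close>)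
  finally have 1: "bdry V (bdry V c) T = (\<Sum>v\<in>V-T. \<Sum>u\<in>V-T. g v u)" .
  have anti: "g v u = - g u v" if "v \<in> V - T" "u \<in> V - T" for u v
  proof (cases "u = v")
    case False
    have "insert u (insert v T) = insert v (insert u T)" by blast
    moreover have "sg (insert v T) u = (if v < u then - sg T u else sg T u)"
      "sg (insert u T) v = (if u < v then - sg T v else sg T v)"
      using that fT by (simp_all add: sg_insert)
    ultimately show ?thesis using False by (auto simp: g_def)
  qed (simp add: g_def)
  have "(\<Sum>v\<in>V-T. \<Sum>u\<in>V-T. g v u) = (\<Sum>v\<in>V-T. \<Sum>u\<in>V-T. - g u v)"
    by (intro sum.cong refl anti)
  also have "\<dots> = - (\<Sum>u\<in>V-T. \<Sum>v\<in>V-T. g u v)"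
    by (subst sum.swap) (simp add: sum_negf)
  finally show ?thesis using 1 by simp
qed

lemma bdry_add: "bdry V (\<lambda>S. c S + k * d S) T = bdry V c T + k * bdry V d T"
  by (simp add: bdry_def algebra_simps sum.distrib sum_distrib_left)

lemma bdry_schains:
  assumes K: "\<And>S T. S \<in> K \<Longrightarrow> T \<subseteq> S \<Longrightarrow> T \<in> K" and "K \<subseteq> Pow V" "finite V" "c \<in> schains K i"
  shows "bdry V c \<in> schains K (i - 1)"
  unfolding schains_def
proof (intro CollectI allI impI)
  fix T assume "bdry V c T \<noteq> 0"
  then obtain v where v: "v \<in> V - T" "c (insert v T) \<noteq> 0"
    unfolding bdry_def by (metis (no_types, lifting) mult_zero_right sum.neutral)
  have 1: "insert v T \<in> K" "int (card (insert v T)) = i + 1"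
    using schainsD[OF assms(4) v(2)] by auto
  moreover have "finite T" using 1 assms(2,3) by (meson PowD finite_insert in_mono rev_finite_subset)
  ultimately show "T \<in> K \<and> int (card T) = i - 1 + 1"
    using v K[of "insert v T" T] by auto
qed

definition single :: "'a set \<Rightarrow> 'a set \<Rightarrow> int" where
  "single R S = (if S = R then 1 else 0)"

lemma bdry_single:
  assumes "finite V" "v \<in> V - T"
  shows "bdry V (single (insert v T)) T = sg T v"
proof -
  have "bdry V (single (insert v T)) T = (\<Sum>u\<in>V-T. if u = v then sg T v else 0)"
    unfolding bdry_def single_def by (intro sum.cong) (use assms in auto)
  then show ?thesis using assms by simp
qed

lemma single_chain: "R \<in> K \<Longrightarrow> single R \<in> schains K (int (card R) - 1)"
  by (simp add: schains_def single_def)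

lemma schains_mono: "K \<subseteq> K' \<Longrightarrow> schains K i \<subseteq> schains K' i"
  unfolding schains_def by blast

lemma schains_add: "c \<in> schains K i \<Longrightarrow> d \<in> schains K i \<Longrightarrow> (\<lambda>S. c S + k * d S) \<in> schains K i"
  unfolding schains_def
proof (intro CollectI allI impI)
  fix S assume "c \<in> {c. \<forall>S. c S \<noteq> 0 \<longrightarrow> S \<in> K \<and> int (card S) = i + 1}"
    "d \<in> {c. \<forall>S. c S \<noteq> 0 \<longrightarrow> S \<in> K \<and> int (card S) = i + 1}" "c S + k * d S \<noteq> 0"
  moreover from this(3) have "c S \<noteq> 0 \<or> d S \<noteq> 0" by auto
  ultimately show "S \<in> K \<and> int (card S) = i + 1" by blast
qed

lemma schains_restrict:
  "c \<in> schains K' i \<Longrightarrow> (\<And>S. S \<in> K' \<Longrightarrow> c S \<noteq> 0 \<Longrightarrow> S \<in> K) \<Longrightarrow> c \<in> schains K i"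
  unfolding schains_def by blast

definition exact_at :: "'a::linorder set \<Rightarrow> 'a set set \<Rightarrow> int \<Rightarrow> bool" where
  "exact_at V K i \<longleftrightarrow> (\<forall>c\<in>schains K i. bdry V c = (\<lambda>T. 0) \<longrightarrow> c \<in> bdry V ` schains K (i + 1))"

lemma bdry_coface_free:
  assumes "c \<in> schains K i" "\<And>v. v \<notin> T \<Longrightarrow> insert v T \<notin> K"
  shows "bdry V c T = 0"
  unfolding bdry_def
proof (intro sum.neutral ballI)
  fix v assume "v \<in> V - T"
  then have "insert v T \<notin> K" using assms(2) by blast
  then have "c (insert v T) = 0" using schainsD(1)[OF assms(1)] by blast
  then show "sg T v * c (insert v T) = 0" by simp
qed

lemma exact_at_pair:
  assumes dc: "\<And>S T. S \<in> K' \<Longrightarrow> T \<subseteq> S \<Longrightarrow> T \<in> K'" and sub: "K' \<subseteq> Pow V" and V: "finite V"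
    and K': "K' = insert T (insert (insert v T) K)" and v: "v \<notin> T" and TK: "\<forall>Y\<in>K. \<not> T \<subseteq> Y"
  shows "exact_at V K' i = exact_at V K i"
proof -
  let ?R = "insert v T"
  define z where "z = bdry V (single ?R)"
  have RV: "v \<in> V - T" and fT: "finite T" using sub K' v V by (auto intro: finite_subset)
  have RK: "?R \<notin> K" using TK by auto
  have cof: "u = v" if "u \<notin> T" "insert u T \<in> K'" for u
    using that TK K' v by (auto simp: subset_insertI)
  have zT: "z T = sg T v" using bdry_single[OF V RV] by (simp add: z_def)
  have z_chain: "z \<in> schains K' (int (card T) - 1)"
    using bdry_schains[OF dc sub V single_chain[of ?R K']] K' v fT by (simp add: z_def)
  have zz: "bdry V z S = 0" for S
    unfolding z_def by (rule bdry_bdry[OF V]) (use RV sub K' in \<open>auto simp: single_def split: if_splits\<close>)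
  have bT: "bdry V b T = sg T v * b ?R" if "b \<in> schains K' j" for b j
  proof -
    have "bdry V b T = (\<Sum>u\<in>V-T. if u = v then sg T v * b ?R else 0)"
      unfolding bdry_def using cof schainsD(1)[OF that] by (intro sum.cong) auto
    then show ?thesis using V RV by simp
  qed
  \<comment> \<open>the boundary of the new cell absorbs the coefficient at its free face\<close>
  have clear: "\<exists>d\<in>schains K' j. d T = 0 \<and> bdry V d = bdry V b \<and> (\<exists>k. \<forall>S. d S = b S + k * z S)
      \<and> (b T = 0 \<longrightarrow> d = b)"
    if "b \<in> schains K' j" for b j
  proof (cases "b T = 0")
    case True then show ?thesis using that by (intro bexI[of _ b]) (auto intro: exI[of _ 0])
  next
    case False
    then have j: "j = int (card T) - 1" using schainsD(2)[OF that False] by simp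
    let ?d = "\<lambda>S. b S + (- b T * sg T v) * z S"
    have "?d \<in> schains K' j" using schains_add[OF that] z_chain j by blast
    moreover have "?d T = 0" using sg_square[of T v] by (simp add: zT)
    moreover have "bdry V ?d = bdry V b" by (rule ext, subst bdry_add) (simp add: zz)
    ultimately show ?thesis using False by (intro bexI[of _ ?d] conjI exI[of _ "- b T * sg T v"]) simp_all
  qed
  have restr: "b \<in> schains K j" if "b \<in> schains K' j" "b T = 0" "b ?R = 0" for b j
    by (rule schains_restrict[OF that(1)]) (use that K' in auto)
  have Tno: "b ?R = 0" if "b \<in> schains K' j" "b T \<noteq> 0" for b j
    using schainsD(2)[OF that] schainsD(2)[OF that(1), of ?R] fT v by auto
  show ?thesis
  proof
    assume ex: "exact_at V K i"
    show "exact_at V K' i"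
      unfolding exact_at_def
    proof (intro ballI impI)
      fix c assume c: "c \<in> schains K' i" "bdry V c = (\<lambda>T. 0)"
      have cR: "c ?R = 0" using bT[OF c(1)] c(2) sg_square[of T v] by auto
      obtain d k where d: "d \<in> schains K' i" "d T = 0" "bdry V d = bdry V c" "\<forall>S. d S = c S + k * z S"
          "c T = 0 \<longrightarrow> d = c"
        using clear[OF c(1)] by blast
      have dR: "d ?R = 0" using bT[OF d(1)] d(3) c(2) sg_square[of T v] by auto
      then have "d \<in> schains K i" using restr d by blast
      then obtain e where e: "e \<in> schains K (i+1)" "d = bdry V e"
        using ex d(3) c(2) unfolding exact_at_def by auto
      have eK': "e \<in> schains K' (i+1)" using schains_mono[of K K'] e(1) K' by blast
      show "c \<in> bdry V ` schains K' (i+1)"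
      proof (cases "c T = 0")
        case True then show ?thesis using d(5) e eK' by auto
      next
        case False
        then have i: "i = int (card T) - 1" using schainsD(2)[OF c(1)] by simp
        have "single ?R \<in> schains K' (i+1)" using single_chain[of ?R K'] K' i fT v by simp
        then have "(\<lambda>S. e S + (-k) * single ?R S) \<in> schains K' (i+1)" using schains_add[OF eK'] by blast
        moreover have "bdry V (\<lambda>S. e S + (-k) * single ?R S) = c"
          by (rule ext, subst bdry_add) (use e(2) d(4) z_def in auto)
        ultimately show ?thesis by blast
      qed
    qed
  next
    assume ex: "exact_at V K' i"
    show "exact_at V K i"
      unfolding exact_at_def
    proof (intro ballI impI)
      fix c assume c: "c \<in> schains K i" "bdry V c = (\<lambda>T. 0)"
      have "c \<in> schains K' i" using schains_mono[of K K'] c(1) K' by blast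
      then obtain b where b: "b \<in> schains K' (i+1)" "c = bdry V b"
        using ex c(2) unfolding exact_at_def by auto
      obtain d where d: "d \<in> schains K' (i+1)" "d T = 0" "bdry V d = bdry V b"
        using clear[OF b(1)] by blast
      have "T \<notin> K" using TK by blast
      then have "c T = 0" using schainsD(1)[OF c(1)] by blast
      then have "d ?R = 0" using bT[OF d(1)] d(3) b(2) sg_square[of T v] by auto
      then have "d \<in> schains K (i+1)" using restr d by blast
      then show "c \<in> bdry V ` schains K (i+1)" using b d by (metis imageI)
    qed
  qed
qed

lemma exact_at_crit:
  assumes dc: "\<And>S T. S \<in> K' \<Longrightarrow> T \<subseteq> S \<Longrightarrow> T \<in> K'" and sub: "K' \<subseteq> Pow V" and V: "finite V"
    and K': "K' = insert T K" and TK: "\<forall>Y\<in>K. \<not> T \<subseteq> Y"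
    and ex: "exact_at V K (int (card T) - 2)"
  shows "exact_at V K' i \<longleftrightarrow> i \<noteq> int (card T) - 1 \<and> exact_at V K i"
proof -
  have TnK: "T \<notin> K" using TK by blast
  have same: "schains K' j = schains K j" if "j \<noteq> int (card T) - 1" for j
    using that K' by (auto simp: schains_def)
  have coface: "insert v T \<notin> K'" if "v \<notin> T" for v
    using that TK K' by auto
  consider "i = int (card T) - 1" | "i = int (card T) - 2" | "i \<noteq> int (card T) - 1" "i + 1 \<noteq> int (card T) - 1"
    by linarith
  then show ?thesis
  proof cases
    case 1
    define z where "z = bdry V (single T)"
    have sT: "single T \<in> schains K' i" using single_chain[of T K'] K' 1 by simp
    have "z \<in> schains K' (i - 1)" unfolding z_def by (rule bdry_schains[OF dc sub V sT])
    then have z: "z \<in> schains K (i - 1)" using same 1 by simp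
    have "bdry V z = (\<lambda>T. 0)"
      unfolding z_def by (rule ext, rule bdry_bdry[OF V]) (use sub K' in \<open>auto simp: single_def split: if_splits\<close>)
    moreover have "i - 1 = int (card T) - 2" using 1 by simp
    then have "exact_at V K (i - 1)" using ex by (simp only:)
    ultimately obtain b where b: "b \<in> schains K i" "z = bdry V b"
      using z unfolding exact_at_def by auto
    let ?c = "\<lambda>S. single T S + (-1) * b S"
    have "b \<in> schains K' i" using schains_mono[of K K'] b(1) K' by blast
    then have c: "?c \<in> schains K' i" using schains_add[OF sT] by blast
    have "bdry V ?c = (\<lambda>T. 0)"
    proof
      fix S
      have "bdry V (single T) S = bdry V b S" using b(2) unfolding z_def by (rule fun_cong)
      then show "bdry V ?c S = 0" by (subst bdry_add) simp
    qed
    moreover have "b T = 0" using schainsD(1)[OF b(1)] TnK by blast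
    then have "?c T = 1" by (simp add: single_def)
    moreover have "bdry V e T = 0" if "e \<in> schains K' (i+1)" for e
      by (rule bdry_coface_free[OF that coface])
    ultimately have "?c \<noteq> bdry V e" if "e \<in> schains K' (i+1)" for e
      using that by (metis zero_neq_one)
    then have "?c \<notin> bdry V ` schains K' (i+1)" by blast
    then have "\<not> exact_at V K' i"
      unfolding exact_at_def using c \<open>bdry V ?c = (\<lambda>T. 0)\<close> by blast
    then show ?thesis using 1 by simp
  next
    case 2
    have "schains K' i = schains K i" using same 2 by simp
    moreover have "schains K (i + 1) \<subseteq> schains K' (i + 1)" using K' by (blast intro!: schains_mono)
    moreover have "exact_at V K i" using ex 2 by simp
    ultimately have "exact_at V K' i" unfolding exact_at_def by blast
    then show ?thesis using 2 \<open>exact_at V K i\<close> by simp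
  next
    case 3
    then have "schains K' i = schains K i" "schains K' (i + 1) = schains K (i + 1)"
      using same by blast+
    then show ?thesis using 3(1) by (simp add: exact_at_def)
  qed
qed

lemma tower_exact_at:
  assumes "tower C K" "\<And>S T. S \<in> K \<Longrightarrow> T \<subseteq> S \<Longrightarrow> T \<in> K" "K \<subseteq> Pow V" "finite V" "\<And>t. t \<in> C \<Longrightarrow> Suc t \<notin> C"
  shows "exact_at V K i \<longleftrightarrow> i + 1 \<notin> int ` C"
  using assms
proof (induction arbitrary: i)
  case empty
  show ?case by (auto simp: exact_at_def schains_def image_iff bdry_def intro!: exI[of _ "\<lambda>S. 0"])
next
  case (pair C F T v)
  have "exact_at V F i \<longleftrightarrow> i + 1 \<notin> int ` C"
  proof (rule pair.IH)
    fix S Y assume "S \<in> F" "Y \<subseteq> S"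
    then show "Y \<in> F" using pair.prems(1)[of S Y] pair.hyps by blast
  qed (use pair.prems in auto)
  moreover have "exact_at V (insert T (insert (insert v T) F)) i = exact_at V F i"
    by (rule exact_at_pair[OF pair.prems(1-3) refl pair.hyps(3,5)])
  ultimately show ?case by (simp only:)
next
  case (crit C F T)
  have IH: "exact_at V F i \<longleftrightarrow> i + 1 \<notin> int ` C" for i
  proof (rule crit.IH)
    fix S Y assume "S \<in> F" "Y \<subseteq> S"
    then show "Y \<in> F" using crit.prems(1)[of S Y] crit.hyps by blast
  qed (use crit.prems in auto)
  have "int (card T) - 2 + 1 \<notin> int ` C"
  proof
    assume "int (card T) - 2 + 1 \<in> int ` C"
    then obtain t where "t \<in> C" "int (card T) = int t + 1" by auto
    then show False using crit.prems(4)[of t] by auto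
  qed
  then have "exact_at V F (int (card T) - 2)" using IH by blast
  then have "exact_at V (insert T F) i \<longleftrightarrow> i \<noteq> int (card T) - 1 \<and> exact_at V F i"
    using crit.prems(1-3) crit.hyps(3)
    by (intro exact_at_crit[where K = F and T = T and K' = "insert T F"]) (simp_all only: refl)
  moreover have "i + 1 = int (card T) \<longleftrightarrow> i = int (card T) - 1" by linarith
  ultimately show ?case unfolding IH image_insert insert_iff by blast
qed

lemma boundary_eq_bdry:
  assumes dc: "\<And>S T. S \<in> K \<Longrightarrow> T \<subseteq> S \<Longrightarrow> T \<in> K" and sub: "K \<subseteq> Pow V" and V: "finite V"
    and c: "c \<in> schains K i"
  shows "boundary K c = bdry V c"
proof
  fix T
  have "(\<Sum>v\<in>{v. v \<notin> T \<and> insert v T \<in> K}. sg T v * c (insert v T)) = bdry V c T"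
    unfolding bdry_def
    by (rule sum.mono_neutral_left) (use sub V schainsD(1)[OF c] in auto)
  moreover have "bdry V c T = 0" if "T \<notin> K"
    by (rule bdry_coface_free[OF c]) (use that dc in blast)
  ultimately show "boundary K c T = bdry V c T"
    by (simp add: boundary_def sg_def)
qed

lemma reduced_homology_nontrivial_iff:
  assumes dc: "\<And>S T. S \<in> K \<Longrightarrow> T \<subseteq> S \<Longrightarrow> T \<in> K" and sub: "K \<subseteq> Pow V" and V: "finite V"
  shows "carrier (reduced_homology K i) \<noteq> {\<one>\<^bsub>reduced_homology K i\<^esub>} \<longleftrightarrow> \<not> exact_at V K i"
proof -
  define B where "B = bdry V ` schains K (i + 1)"
  define Z where "Z = {c \<in> schains K i. bdry V c = (\<lambda>S. 0)}"
  have B: "boundaries K i = B"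
    unfolding boundaries_def carrier_chain_group B_def
    by (intro image_cong refl boundary_eq_bdry[OF dc sub V])
  have Z: "cycles K i = Z"
    unfolding cycles_def carrier_chain_group Z_def using boundary_eq_bdry[OF dc sub V] by auto
  define coset where "coset a = (\<lambda>h S. h S + a S) ` B" for a :: "'a set \<Rightarrow> int"
  have car: "carrier (reduced_homology K i) = coset ` Z"
    by (auto simp: reduced_homology_def FactGroup_def RCOSETS_def r_coset_def B Z coset_def chain_group_def)
  have one: "\<one>\<^bsub>reduced_homology K i\<^esub> = B"
    by (simp add: reduced_homology_def FactGroup_def B)
  have 0: "(\<lambda>S. 0) \<in> schains K j" for j by (simp add: schains_def)
  then have 0: "(\<lambda>S. 0) \<in> Z" "(\<lambda>S. 0) \<in> B"
    by (auto simp: Z_def B_def bdry_def image_iff intro!: bexI[of _ "\<lambda>S. 0"])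
  have add: "(\<lambda>S. a S + k * b S) \<in> B" if "a \<in> B" "b \<in> B" for a b k
  proof -
    obtain a' b' where ab: "a' \<in> schains K (i+1)" "b' \<in> schains K (i+1)" "a = bdry V a'" "b = bdry V b'"
      using \<open>a \<in> B\<close> \<open>b \<in> B\<close> unfolding B_def by blast
    then have "bdry V (\<lambda>S. a' S + k * b' S) = (\<lambda>S. a S + k * b S)"
      by (intro ext) (simp add: bdry_add)
    moreover have "(\<lambda>S. a' S + k * b' S) \<in> schains K (i+1)" using schains_add ab by blast
    ultimately show ?thesis unfolding B_def by (intro image_eqI[of _ _ "\<lambda>S. a' S + k * b' S"]) simp_all
  qed
  have cB: "coset a = B" if "a \<in> B" for a
  proof
    have "(\<lambda>S. h S + a S) \<in> B" if "h \<in> B" for h using add[OF that \<open>a \<in> B\<close>, of 1] by simp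
    then show "coset a \<subseteq> B" unfolding coset_def by blast
    show "B \<subseteq> coset a"
    proof
      fix b assume "b \<in> B"
      then have "(\<lambda>S. b S + (-1) * a S) \<in> B" using add that by blast
      moreover have "b = (\<lambda>S. (b S + (-1) * a S) + a S)" by simp
      ultimately show "b \<in> coset a"
        unfolding coset_def by (intro image_eqI[of b _ "\<lambda>S. b S + (-1) * a S"])
    qed
  qed
  have ca: "a \<in> coset a" for a
    unfolding coset_def by (rule image_eqI[OF _ 0(2)]) simp
  have "coset ` Z = {B} \<longleftrightarrow> Z \<subseteq> B"
  proof
    assume Z: "coset ` Z = {B}"
    show "Z \<subseteq> B"
    proof
      fix a assume "a \<in> Z"
      then have "coset a = B" using Z by blast
      then show "a \<in> B" using ca[of a] by simp
    qed
  next
    assume "Z \<subseteq> B"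
    then have "coset ` Z = (\<lambda>a. B) ` Z" by (intro image_cong refl cB) (rule subsetD)
    then show "coset ` Z = {B}" using 0(1) by (simp add: image_constant)
  qed
  moreover have "exact_at V K i \<longleftrightarrow> Z \<subseteq> B" unfolding exact_at_def Z_def B_def by blast
  ultimately show ?thesis unfolding car one by blast
qed

section \<open>Building families by toggling\<close>

lemma tower_append:
  assumes "tower C' G" "tower C F" "\<And>S S'. S \<in> G \<Longrightarrow> S' \<in> F \<Longrightarrow> \<not> S \<subseteq> S'"
  shows "tower (C \<union> C') (F \<union> G)"
  using assms
proof (induction)
  case empty then show ?case by simp
next
  case (pair C' G T v)
  have "tower (C \<union> C') (F \<union> G)" using pair.prems by (intro pair.IH) auto
  moreover have "\<not> T \<subseteq> Y" "\<not> insert v T \<subseteq> Y" if "Y \<in> F \<union> G" for Y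
    using pair.prems(2)[of T Y] pair.prems(2)[of "insert v T" Y] pair.hyps(5) that by auto
  ultimately have "tower (C \<union> C') (insert T (insert (insert v T) (F \<union> G)))"
    using pair.hyps(3) by (intro tower.pair) auto
  then show ?case by simp
next
  case (crit C' G T)
  have "tower (C \<union> C') (F \<union> G)" using crit.prems by (intro crit.IH) auto
  moreover have "\<not> T \<subseteq> Y" if "Y \<in> F \<union> G" for Y
    using crit.prems(2)[of T Y] crit.hyps(3) that by auto
  ultimately have "tower (insert (card T) (C \<union> C')) (insert T (F \<union> G))"
    by (intro tower.crit) auto
  then show ?case by simp
qed

lemma tower_single: "tower {card T} {T}"
  using tower.crit[OF tower.empty, of T] by simp

lemma tower_toggle:
  assumes "finite F" "\<And>S. S \<in> F \<Longrightarrow> insert v S \<in> F" "\<And>S. S \<in> F \<Longrightarrow> S - {v} \<in> F"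
  shows "tower {} F"
  using assms
proof (induction "card F" arbitrary: F rule: less_induct)
  case less
  show ?case
  proof (cases "F = {}")
    case True then show ?thesis by (simp add: tower.empty)
  next
    case False
    let ?M = "{S \<in> F. v \<notin> S}"
    have "?M \<noteq> {}" using False less.prems(3) by (metis (mono_tags, lifting) Diff_iff all_not_in_conv insertI1 mem_Collect_eq)
    moreover have "finite ?M" using less.prems(1) by simp
    ultimately obtain T where T: "T \<in> ?M" "\<And>S. S \<in> ?M \<Longrightarrow> T \<subseteq> S \<Longrightarrow> S = T"
      using finite_has_maximal[of ?M] by metis
    let ?G = "F - {T, insert v T}"
    have TF: "T \<in> F" "insert v T \<in> F" "v \<notin> T" using T(1) less.prems(2) by auto
    have "card ?G < card F" using TF less.prems(1) by (intro psubset_card_mono) auto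
    then have "tower {} ?G"
    proof (rule less.hyps)
      show "finite ?G" using less.prems(1) by simp
      show "insert v S \<in> ?G" if "S \<in> ?G" for S
      proof -
        have "insert v S \<noteq> T" "insert v S \<noteq> insert v T"
          subgoal using TF(3) by blast
          subgoal using that TF(3) by (cases "v \<in> S") (simp add: insert_absorb, simp add: insert_ident)
          done
        then show ?thesis using that less.prems(2) by auto
      qed
      show "S - {v} \<in> ?G" if "S \<in> ?G" for S
      proof -
        have "S - {v} \<noteq> T" "S - {v} \<noteq> insert v T"
          subgoal using that TF(3) by (metis DiffE Diff_empty Diff_insert0 insertCI insert_Diff insert_absorb)
          subgoal by blast
          done
        then show ?thesis using that less.prems(3) by auto
      qed
    qed
    moreover have "\<not> T \<subseteq> Y" if Y: "Y \<in> ?G" for Y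
    proof
      assume TY: "T \<subseteq> Y"
      have "Y - {v} \<in> ?M" using Y less.prems(3) by auto
      then have "Y - {v} = T" using T(2) TY TF(3) by blast
      then show False using Y by auto
    qed
    ultimately have "tower {} (insert T (insert (insert v T) ?G))"
      using TF by (intro tower.pair) auto
    moreover have "insert T (insert (insert v T) ?G) = F" using TF by blast
    ultimately show ?thesis by simp
  qed
qed

lemma tower_fibres:
  fixes \<phi> :: "'a set \<Rightarrow> 'b::order"
  assumes "finite F" "\<And>S T. S \<in> F \<Longrightarrow> T \<in> F \<Longrightarrow> S \<subseteq> T \<Longrightarrow> \<phi> S \<le> \<phi> T"
    "\<And>b. b \<in> \<phi> ` F \<Longrightarrow> tower (c b) {S\<in>F. \<phi> S = b}"
  shows "tower (\<Union>b\<in>\<phi> ` F. c b) F"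
  using assms
proof (induction "card F" arbitrary: F rule: less_induct)
  case less
  show ?case
  proof (cases "F = {}")
    case True then show ?thesis by (simp add: tower.empty)
  next
    case False
    then obtain b where b: "b \<in> \<phi> ` F" "\<And>x. x \<in> \<phi> ` F \<Longrightarrow> b \<le> x \<Longrightarrow> x = b"
      using finite_has_maximal[of "\<phi> ` F"] less.prems(1) by (metis finite_imageI image_is_empty)
    let ?G = "{S\<in>F. \<phi> S \<noteq> b}"
    have fib: "{S \<in> ?G. \<phi> S = x} = {S \<in> F. \<phi> S = x}" if "x \<in> \<phi> ` ?G" for x using that by auto
    have "?G \<subset> F" using b(1) by auto
    then have "card ?G < card F" using less.prems(1) by (intro psubset_card_mono)
    then have "tower (\<Union>x\<in>\<phi> ` ?G. c x) ?G"
      by (rule less.hyps) (use less.prems fib in auto)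
    moreover have "\<not> S \<subseteq> S'" if S: "S \<in> {S\<in>F. \<phi> S = b}" "S' \<in> ?G" for S S'
    proof
      assume "S \<subseteq> S'"
      then have "b \<le> \<phi> S'" using less.prems(2)[of S S'] S by auto
      then show False using b(2)[of "\<phi> S'"] S(2) by auto
    qed
    ultimately have "tower ((\<Union>x\<in>\<phi> ` ?G. c x) \<union> c b) (?G \<union> {S\<in>F. \<phi> S = b})"
      using tower_append less.prems(3)[OF b(1)] by blast
    moreover have "?G \<union> {S\<in>F. \<phi> S = b} = F" by blast
    moreover have "\<phi> ` F = insert b (\<phi> ` ?G)" using b(1) by auto
    then have "(\<Union>x\<in>\<phi> ` ?G. c x) \<union> c b = (\<Union>x\<in>\<phi> ` F. c x)" by (simp add: Un_commute)
    ultimately show ?thesis by simp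
  qed
qed

lemma tower_fibres_empty:
  fixes \<phi> :: "'a set \<Rightarrow> 'b::order"
  assumes "finite F" "\<And>S T. S \<in> F \<Longrightarrow> T \<in> F \<Longrightarrow> S \<subseteq> T \<Longrightarrow> \<phi> S \<le> \<phi> T"
    "\<And>S. S \<in> F \<Longrightarrow> tower {} {S'\<in>F. \<phi> S' = \<phi> S}"
  shows "tower {} F"
proof -
  have "tower (\<Union>b\<in>\<phi> ` F. {}) F" by (rule tower_fibres) (use assms in auto)
  then show ?thesis by simp
qed

lemma inj_on_image_subset:
  assumes "inj_on f D" "A \<subseteq> D" "B \<subseteq> D"
  shows "f ` A \<subseteq> f ` B \<longleftrightarrow> A \<subseteq> B"
proof
  assume "f ` A \<subseteq> f ` B"
  then show "A \<subseteq> B" using assms by (metis image_eqI inj_on_image_mem_iff subset_iff)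
qed (rule image_mono)

lemma tower_image:
  assumes "tower C F" "inj_on f (\<Union>F)"
  shows "tower C ((`) f ` F)"
  using assms
proof (induction)
  case empty then show ?case by (simp add: tower.empty)
next
  case (pair C F T v)
  have sub: "f ` A \<subseteq> f ` B \<longleftrightarrow> A \<subseteq> B" if "A \<subseteq> \<Union>(insert T (insert (insert v T) F))" "B \<subseteq> \<Union>(insert T (insert (insert v T) F))" for A B
    using inj_on_image_subset[OF pair.prems that] .
  have "tower C ((`) f ` F)" using pair.prems by (intro pair.IH) (auto intro: inj_on_subset)
  moreover have no: "\<not> f ` T \<subseteq> f ` Y" if "Y \<in> F" for Y using sub[of T Y] pair.hyps(5) that by auto
  moreover have "f v \<notin> f ` T" using sub[of "{v}" T] pair.hyps(3) by auto
  ultimately have "tower C (insert (f ` T) (insert (insert (f v) (f ` T)) ((`) f ` F)))"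
    by (intro tower.pair) force+
  then show ?case by simp
next
  case (crit C F T)
  have sub: "f ` A \<subseteq> f ` B \<longleftrightarrow> A \<subseteq> B" if "A \<subseteq> \<Union>(insert T F)" "B \<subseteq> \<Union>(insert T F)" for A B
    using inj_on_image_subset[OF crit.prems that] .
  have "tower C ((`) f ` F)" using crit.prems by (intro crit.IH) (auto intro: inj_on_subset)
  moreover have "\<not> f ` T \<subseteq> f ` Y" if "Y \<in> F" for Y using sub[of T Y] crit.hyps(3) that by auto
  ultimately have "tower (insert (card (f ` T)) C) (insert (f ` T) ((`) f ` F))"
    by (intro tower.crit) force+
  moreover have "card (f ` T) = card T" using crit.prems by (intro card_image) (auto intro: inj_on_subset)
  ultimately show ?case by simp
qed

lemma tower_insert_vertex:
  assumes "tower C F" "C = {}" "z \<notin> \<Union>F"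
  shows "tower {} (insert z ` F)"
  using assms
proof (induction)
  case empty then show ?case by (simp add: tower.empty)
next
  case (pair C F T v)
  have "tower {} (insert z ` F)" using pair.prems by (intro pair.IH) auto
  moreover have no: "\<not> insert z T \<subseteq> insert z Y" if "Y \<in> F" for Y
    using pair.hyps(5) pair.prems that by (auto simp: subset_insert)
  moreover have "v \<notin> insert z T" using pair.hyps(3) pair.prems by auto
  ultimately have "tower {} (insert (insert z T) (insert (insert v (insert z T)) (insert z ` F)))"
    by (intro tower.pair) force+
  then show ?case by (simp add: insert_commute)
qed simp

section \<open>Cliques varying in at least five directions\<close>

definition sdiff :: "'a set \<Rightarrow> 'a set \<Rightarrow> 'a set" where
  "sdiff A B = (A - B) \<union> (B - A)"

definition clique :: "'a set set \<Rightarrow> bool" where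
  "clique S \<longleftrightarrow> (\<forall>A\<in>S. \<forall>B\<in>S. card (sdiff A B) \<le> 3)"

definition vary :: "'a set set \<Rightarrow> 'a set" where
  "vary S = \<Union>S - \<Inter>S"

definition wide :: "'a set \<Rightarrow> 'a set set set" where
  "wide N = {S. S \<subseteq> Pow N \<and> clique S \<and> 5 \<le> card (vary S)}"

lemma sdiff_commute: "sdiff A B = sdiff B A"
  by (auto simp: sdiff_def)

lemma sdiff_empty [simp]: "sdiff {} B = B" "sdiff B {} = B"
  by (auto simp: sdiff_def)

lemma sdiff_self [simp]: "sdiff A A = {}"
  by (auto simp: sdiff_def)

lemma sdiff_cancel [simp]: "sdiff w (sdiff w A) = A"
  by (auto simp: sdiff_def)

lemma sdiff_translate [simp]: "sdiff (sdiff w A) (sdiff w B) = sdiff A B"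
  by (auto simp: sdiff_def)

lemma sdiff_subset: "A \<subseteq> N \<Longrightarrow> B \<subseteq> N \<Longrightarrow> sdiff A B \<subseteq> N"
  by (auto simp: sdiff_def)

lemma card_sdiff:
  assumes "finite A" "finite B"
  shows "card (sdiff A B) + 2 * card (A \<inter> B) = card A + card B"
proof -
  have "card (sdiff A B) = card (A - B) + card (B - A)"
    unfolding sdiff_def using assms by (intro card_Un_disjoint) auto
  moreover have "card A = card (A - B) + card (A \<inter> B)"
    by (metis assms(1) card_Int_Diff add.commute)
  moreover have "card B = card (B - A) + card (A \<inter> B)"
    by (metis assms(2) card_Int_Diff add.commute Int_commute)
  ultimately show ?thesis by simp
qed

lemma even_card_sdiff:
  assumes "finite A" "finite B"
  shows "even (card (sdiff A B)) \<longleftrightarrow> (even (card A) \<longleftrightarrow> even (card B))"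
proof -
  have "even (card (sdiff A B) + 2 * card (A \<inter> B)) \<longleftrightarrow> even (card A + card B)"
    using card_sdiff[OF assms] by simp
  then show ?thesis by simp
qed

lemma image_sdiff_cancel [simp]: "sdiff w ` (sdiff w ` S) = S"
  by (simp add: image_image)

lemma vary_translate [simp]: "vary (sdiff w ` S) = vary S"
proof (cases "S = {}")
  case False
  have "i \<in> vary (sdiff w ` S) \<longleftrightarrow> i \<in> vary S" for i
    by (cases "i \<in> w") (auto simp: vary_def sdiff_def)
  then show ?thesis by blast
qed simp

lemma clique_translate [simp]: "clique (sdiff w ` S) = clique S"
  by (simp add: clique_def)

lemma finite_wide: "finite N \<Longrightarrow> finite (wide N)"
  by (rule finite_subset[of _ "Pow (Pow N)"]) (auto simp: wide_def)

lemma wide_translate: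
  assumes "w \<subseteq> N" shows "sdiff w ` S \<in> wide N \<longleftrightarrow> S \<in> wide N"
proof -
  have "sdiff w ` S \<subseteq> Pow N" if "S \<subseteq> Pow N" for S
    using that assms by (auto simp: sdiff_def)
  from this[of S] this[of "sdiff w ` S"] show ?thesis by (auto simp: wide_def)
qed

lemma tower_translate:
  assumes "w \<subseteq> N" "tower C {S \<in> wide N. P (sdiff w ` S)}"
  shows "tower C {S \<in> wide N. P S}"
proof -
  have "inj_on (sdiff w) A" for A by (rule inj_on_inverseI[of _ "sdiff w"]) simp
  then have "tower C ((`) (sdiff w) ` {S \<in> wide N. P (sdiff w ` S)})"
    using tower_image[OF assms(2)] by blast
  moreover have "(`) (sdiff w) ` {S \<in> wide N. P (sdiff w ` S)} = {S \<in> wide N. P S}"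
  proof
    show "{S \<in> wide N. P S} \<subseteq> (`) (sdiff w) ` {S \<in> wide N. P (sdiff w ` S)}"
    proof
      fix S assume S: "S \<in> {S \<in> wide N. P S}"
      then have "sdiff w ` S \<in> {S \<in> wide N. P (sdiff w ` S)}"
        using wide_translate[OF assms(1)] by simp
      then have "sdiff w ` (sdiff w ` S) \<in> (`) (sdiff w) ` {S \<in> wide N. P (sdiff w ` S)}" by blast
      then show "S \<in> (`) (sdiff w) ` {S \<in> wide N. P (sdiff w ` S)}" by simp
    qed
  qed (use wide_translate[OF assms(1)] in auto)
  ultimately show ?thesis by simp
qed

lemma clique_insert: "clique S \<Longrightarrow> (\<And>A. A \<in> S \<Longrightarrow> card (sdiff v A) \<le> 3) \<Longrightarrow> clique (insert v S)"
  unfolding clique_def by (metis card.empty insertE le0 sdiff_commute sdiff_self)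

lemma clique_subset: "clique S \<Longrightarrow> T \<subseteq> S \<Longrightarrow> clique T"
  by (auto simp: clique_def)

lemma vary_insert:
  assumes "Z \<subseteq> S" "v \<subseteq> \<Union>Z" "\<Inter>Z \<subseteq> v"
  shows "vary (insert v S) = vary S"
proof -
  have "v \<subseteq> \<Union>S" "\<Inter>S \<subseteq> v" using assms by blast+
  then show ?thesis unfolding vary_def by auto
qed

lemma tower_wide_toggle:
  assumes N: "finite N" and v: "v \<subseteq> N"
    and P: "\<And>S. P (insert v S) = P S"
    and close: "\<And>S A. S \<in> wide N \<Longrightarrow> P S \<Longrightarrow> A \<in> S \<Longrightarrow> card (sdiff v A) \<le> 3"
    and hull: "\<And>S. S \<in> wide N \<Longrightarrow> P S \<Longrightarrow> \<exists>Z\<subseteq>S - {v}. v \<subseteq> \<Union>Z \<and> \<Inter>Z \<subseteq> v"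
  shows "tower {} {S \<in> wide N. P S}"
proof (rule tower_toggle[of _ v])
  show "finite {S \<in> wide N. P S}" using finite_wide[OF N] by simp
next
  fix S assume "S \<in> {S \<in> wide N. P S}"
  then have S: "S \<in> wide N" "P S" by simp_all
  obtain Z where Z: "Z \<subseteq> S - {v}" "v \<subseteq> \<Union>Z" "\<Inter>Z \<subseteq> v" using hull[OF S] by metis
  have vi: "vary (insert v S) = vary S" by (rule vary_insert) (use Z in auto)
  have "clique (insert v S)" by (rule clique_insert) (use close[OF S] S in \<open>auto simp: wide_def\<close>)
  then show "insert v S \<in> {S \<in> wide N. P S}"
    using S P vi v by (auto simp: wide_def)
  have "vary (S - {v}) = vary (insert v (S - {v}))" by (rule vary_insert[symmetric]) (use Z in auto)
  then have "vary (S - {v}) = vary S" using vi by simp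
  moreover have "P (S - {v}) = P S" using P[of "S - {v}"] P[of S] by simp
  moreover have "clique (S - {v})" using clique_subset[of S "S - {v}"] S by (auto simp: wide_def)
  ultimately show "S - {v} \<in> {S \<in> wide N. P S}" using S by (auto simp: wide_def)
qed

lemma card_sdiff_singleton:
  assumes "finite A"
  shows "card (sdiff {i} A) = (if i \<in> A then card A - 1 else card A + 1)"
proof -
  have "sdiff {i} A = (if i \<in> A then A - {i} else insert i A)" by (auto simp: sdiff_def)
  then show ?thesis using assms by simp
qed

lemma two_elements_of_card:
  assumes "2 \<le> card Q"
  obtains i j where "i \<in> Q" "j \<in> Q" "i \<noteq> j"
proof -
  have "finite Q" using assms by (metis card.infinite not_numeral_le_zero)
  then have "\<not> is_singleton Q" "Q \<noteq> {}" using assms by (auto simp: is_singleton_altdef)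
  then show ?thesis using that is_singletonI' by metis
qed

lemma tower_star:
  assumes N: "finite N" and Q: "Q \<subseteq> N" "2 \<le> card Q"
  shows "tower {} {S \<in> wide N. {A\<in>S. odd (card A)} = (\<lambda>i. {i}) ` Q}"
proof -
  let ?P = "\<lambda>S. {A\<in>S. odd (card A)} = (\<lambda>i. {i}) ` Q"
  have fin: "finite A" if "S \<in> wide N" "A \<in> S" for S A
    using that N by (auto simp: wide_def intro: finite_subset)
  have sing: "{i} \<in> S" if "?P S" "i \<in> Q" for S i using that by blast
  have near: "card A \<le> 4" "card A \<le> 2 \<or> Q \<subseteq> A" if S: "S \<in> wide N" "?P S" "A \<in> S" for S A
  proof -
    have d: "card (sdiff {i} A) \<le> 3" if "i \<in> Q" for i
      using S sing[OF S(2) that] by (auto simp: wide_def clique_def)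
    show "card A \<le> 2 \<or> Q \<subseteq> A"
    proof (rule disjCI)
      assume "\<not> Q \<subseteq> A"
      then obtain i where "i \<in> Q" "i \<notin> A" by blast
      then show "card A \<le> 2" using d[of i] card_sdiff_singleton[OF fin[OF S(1,3)], of i] by simp
    qed
    obtain i where "i \<in> Q" using Q(2) by fastforce
    then show "card A \<le> 4"
      using d[of i] card_sdiff_singleton[OF fin[OF S(1,3)], of i] by (auto split: if_splits)
  qed
  have hull: "\<exists>Z\<subseteq>S - {v}. v \<subseteq> \<Union>Z \<and> \<Inter>Z \<subseteq> v" if S: "?P S" and v: "even (card v)" "v \<subseteq> Q" for S v
  proof (intro exI conjI)
    show "(\<lambda>i. {i}) ` Q \<subseteq> S - {v}" using S v(1) by auto
    show "v \<subseteq> \<Union>((\<lambda>i. {i}) ` Q)" using v(2) by blast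
    obtain i j where "i \<in> Q" "j \<in> Q" "i \<noteq> j" using two_elements_of_card[OF Q(2)] .
    then show "\<Inter>((\<lambda>i. {i}) ` Q) \<subseteq> v" by auto
  qed
  have odds: "{A\<in>insert v S. odd (card A)} = {A\<in>S. odd (card A)}" if "even (card v)" for v :: "'a set" and S
    using that by auto
  define big where "big S \<longleftrightarrow> (\<exists>A\<in>S. card A = 4)" for S :: "'a set set"
  have bigi: "big (insert v S) = big S" if "card v \<noteq> 4" for v S
    using that by (auto simp: big_def)
  show ?thesis
  proof (rule tower_fibres_empty[where \<phi> = big])
    show "finite {S \<in> wide N. ?P S}" using finite_wide[OF N] by simp
    show "big S \<le> big T" if "S \<subseteq> T" for S T using that by (auto simp: big_def)
    fix S0 assume "S0 \<in> {S \<in> wide N. ?P S}"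
    have "tower {} {S \<in> wide N. ?P S \<and> big S = b}" for b
    proof (cases b)
      case False
      show ?thesis
      proof (rule tower_wide_toggle[OF N, of "{}"])
        show "(?P (insert {} S) \<and> big (insert {} S) = b) = (?P S \<and> big S = b)" for S
          by (subst odds, simp, subst bigi, simp, rule refl)
        fix S assume S: "S \<in> wide N" "?P S \<and> big S = b"
        show "\<exists>Z\<subseteq>S - {{}}. {} \<subseteq> \<Union>Z \<and> \<Inter>Z \<subseteq> {}" by (rule hull) (use S in auto)
        fix A assume A: "A \<in> S"
        have "card A \<noteq> 4" using S(2) A False by (auto simp: big_def)
        then show "card (sdiff {} A) \<le> 3" using near(1)[OF S(1) _ A] S(2) by auto
      qed simp
    next
      case True
      obtain T where T: "T \<subseteq> Q" "card T = 2" "finite T" using obtain_subset_with_card_n[OF Q(2)] .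
      show ?thesis
      proof (rule tower_wide_toggle[OF N, of T])
        show "T \<subseteq> N" using T Q by blast
        show "(?P (insert T S) \<and> big (insert T S) = b) = (?P S \<and> big S = b)" for S
          using T(2) by (subst odds, simp, subst bigi, simp, intro refl)
        fix S assume S: "S \<in> wide N" "?P S \<and> big S = b"
        show "\<exists>Z\<subseteq>S - {T}. T \<subseteq> \<Union>Z \<and> \<Inter>Z \<subseteq> T" by (rule hull) (use S T in auto)
        obtain B where B: "B \<in> S" "card B = 4" using S(2) True by (auto simp: big_def)
        have cl: "card (sdiff A A') \<le> 3" if "A \<in> S" "A' \<in> S" for A A'
          using S(1) that by (auto simp: wide_def clique_def)
        have QA: "Q \<subseteq> A" if "A \<in> S" "card A = 4" for A using near(2)[OF S(1) _ that(1)] that(2) S(2) by auto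
        \<comment> \<open>a pair A in S disjoint from T would force S into the four-element set T \<union> A\<close>
        have meet: "A \<inter> T \<noteq> {}" if A: "A \<in> S" "card A = 2" for A
        proof
          assume disj: "A \<inter> T = {}"
          have sub: "A \<subseteq> A'" if A': "A' \<in> S" "card A' = 4" for A'
          proof -
            have "card (sdiff A A') + 2 * card (A \<inter> A') = 2 + 4"
              using card_sdiff[of A A'] fin S(1) A A' by auto
            then have "card A \<le> card (A \<inter> A')" using cl[OF A(1) A'(1)] A(2) by presburger
            then have "A \<inter> A' = A" using fin[OF S(1) A(1)] by (intro card_subset_eq) (auto simp: le_antisym card_mono)
            then show ?thesis by blast
          qed
          have four: "A' = T \<union> A" if A': "A' \<in> S" "card A' = 4" for A'
          proof -
            have "card (T \<union> A) = 4" using disj A(2) T fin[OF S(1) A(1)] by (subst card_Un_disjoint) auto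
            moreover have "T \<union> A \<subseteq> A'" using sub[OF A'] QA[OF A'] T(1) by blast
            ultimately show ?thesis using card_subset_eq[OF fin[OF S(1) A'(1)]] A'(2) by metis
          qed
          have "A' \<subseteq> B" if A': "A' \<in> S" for A'
          proof (cases "odd (card A')")
            case True
            then have "A' \<in> (\<lambda>i. {i}) ` Q" using S(2) A' by blast
            then show ?thesis using QA[OF B] by auto
          next
            case False
            have "card A' \<le> 4" using near(1)[OF S(1) _ A'] S(2) by simp
            then have "card A' = 0 \<or> card A' = 2 \<or> card A' = 4" using False by presburger
            then show ?thesis
            proof (elim disjE)
              assume "card A' = 0" then show ?thesis using fin[OF S(1) A'] by simp
            next
              assume 2: "card A' = 2"
              have "card (sdiff A' B) + 2 * card (A' \<inter> B) = 2 + 4"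
                using card_sdiff[of A' B] fin S(1) A' B 2 by auto
              then have "card A' \<le> card (A' \<inter> B)" using cl[OF A' B(1)] 2 by presburger
              then have "A' \<inter> B = A'" using fin[OF S(1) A'] by (intro card_subset_eq) (auto simp: le_antisym card_mono)
              then show ?thesis by blast
            next
              assume 3: "card A' = 4" then show ?thesis using four[OF A' 3] four[OF B] by simp
            qed
          qed
          then have "vary S \<subseteq> B" by (auto simp: vary_def)
          then have "card (vary S) \<le> 4" using B fin[OF S(1) B(1)] card_mono by metis
          then show False using S(1) by (auto simp: wide_def)
        qed
        fix A assume A: "A \<in> S"
        have ct: "card (sdiff T A) + 2 * card (T \<inter> A) = 2 + card A"
          using card_sdiff[OF T(3) fin[OF S(1) A]] T(2) by simp
        show "card (sdiff T A) \<le> 3"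
        proof (cases "card A = 2")
          case True
          then have "card (T \<inter> A) \<noteq> 0" using meet[OF A] T(3) by (auto simp: Int_commute)
          then show ?thesis using ct True by linarith
        next
          case False
          show ?thesis
          proof (cases "card A \<le> 1")
            case True then show ?thesis using ct by linarith
          next
            case F: False
            then have "T \<subseteq> A" using near(2)[OF S(1) _ A] False S(2) T(1) by auto
            then have "card (T \<inter> A) = 2" using T(2) by (simp add: Int_absorb2)
            then show ?thesis using ct near(1)[OF S(1) _ A] S(2) by linarith
          qed
        qed
      qed
    qed
    then show "tower {} {S' \<in> {S \<in> wide N. ?P S}. big S' = big S0}"
      by (simp add: conj_assoc)
  qed
qed

lemma wide_finite_vertex: "finite N \<Longrightarrow> S \<in> wide N \<Longrightarrow> A \<in> S \<Longrightarrow> finite A"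
  by (auto simp: wide_def intro: finite_subset)

lemma wide_close: "S \<in> wide N \<Longrightarrow> A \<in> S \<Longrightarrow> B \<in> S \<Longrightarrow> card (sdiff A B) \<le> 3"
  by (auto simp: wide_def clique_def)

lemma tower_tetrahedron:
  fixes N :: "'a set"
  assumes N: "finite N" "{a, b, c} \<subseteq> N" and abc: "distinct [a, b, c]"
  shows "tower {} {S \<in> wide N. {A\<in>S. even (card A)} = {{}, {a, b}, {a, c}, {b, c}}}"
proof -
  let ?E = "{{}, {a, b}, {a, c}, {b, c}}"
  let ?P = "\<lambda>S. {A\<in>S. even (card A)} = ?E"
  define M where "M = {a, b, c}"
  have M: "finite M" "card M = 3" "\<Union>?E = M" using abc by (auto simp: M_def)
  define out where "out S = {A\<in>S. odd (card A) \<and> \<not> A \<subseteq> M}" for S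
  note fin = wide_finite_vertex[OF N(1)]
  have ES: "A \<in> S" if "?P S" "A \<in> ?E" for S A using that by blast
  have shape: "card (A - M) = 1 \<and> A \<inter> M \<in> ?E" if S: "S \<in> wide N" "?P S" "A \<in> out S" for S A
  proof -
    have A: "A \<in> S" "odd (card A)" "\<not> A \<subseteq> M" "finite A" using S fin by (auto simp: out_def)
    have near: "card (sdiff B A) \<le> 3" if "B \<in> ?E" for B
      using wide_close[OF S(1) ES[OF S(2) that] A(1)] .
    have "card A \<le> 3" using near[of "{}"] by simp
    then have "card A = 1 \<or> card A = 3" using A(2) by presburger
    then show ?thesis
    proof
      assume "card A = 1"
      then obtain j where "A = {j}" by (rule card_1_singletonE)
      then have "A - M = {j}" "A \<inter> M = {}" using A(3) by auto
      then show ?thesis by simp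
    next
      assume 3: "card A = 3"
      have meet: "B \<inter> A \<noteq> {}" if "B \<in> ?E" "card B = 2" for B
        using card_sdiff[of B A] that near[OF that(1)] A(4) 3 card_ge_0_finite[of B] by auto
      have "\<not> M \<subseteq> A" using card_subset_eq[OF A(4), of M] M(2) 3 A(3) by auto
      moreover have "{a, b} \<inter> A \<noteq> {}" "{a, c} \<inter> A \<noteq> {}" "{b, c} \<inter> A \<noteq> {}"
        using abc by (intro meet; simp)+
      ultimately have AM: "A \<inter> M \<in> {{a, b}, {a, c}, {b, c}}" unfolding M_def by blast
      then have "card (A \<inter> M) = 2" by (elim insertE emptyE) (use abc in simp_all)
      then have "card (A - M) = 1" using card_Int_Diff[OF A(4), of M] 3 by simp
      then show ?thesis using AM by blast
    qed
  qed
  have same: "A \<inter> M = B \<inter> M" if S: "S \<in> wide N" "?P S" "A \<in> out S" "B \<in> out S" "A - M \<noteq> B - M" for S A B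
  proof (rule ccontr)
    assume ne: "A \<inter> M \<noteq> B \<inter> M"
    let ?\<sigma> = "sdiff (A \<inter> M) (B \<inter> M)"
    have AB: "A \<in> S" "B \<in> S" "finite A" "finite B" using S fin by (auto simp: out_def)
    have evE: "even (card C)" if "C \<in> ?E" for C using that abc by auto
    have "even (card ?\<sigma>)"
      using evE shape[OF S(1-3)] shape[OF S(1,2,4)] AB by (subst even_card_sdiff) auto
    moreover have "?\<sigma> \<noteq> {}" using ne by (auto simp: sdiff_def)
    then have "card ?\<sigma> \<noteq> 0" using AB by (auto simp: sdiff_def)
    ultimately have "2 \<le> card ?\<sigma>" by presburger
    moreover have "2 \<le> card (sdiff (A - M) (B - M))"
    proof -
      obtain i j where ij: "A - M = {i}" "B - M = {j}"
        using shape[OF S(1-3)] shape[OF S(1,2,4)] by (metis card_1_singletonE)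
      then have "sdiff (A - M) (B - M) = {i, j}" "i \<noteq> j" using S(5) by (auto simp: sdiff_def)
      then show ?thesis by simp
    qed
    moreover have "sdiff A B = ?\<sigma> \<union> sdiff (A - M) (B - M)" by (auto simp: sdiff_def)
    moreover have "?\<sigma> \<inter> sdiff (A - M) (B - M) = {}" by (auto simp: sdiff_def)
    ultimately have "4 \<le> card (sdiff A B)"
      using AB by (simp add: card_Un_disjoint sdiff_def)
    then show False using wide_close[OF S(1) AB(1,2)] by simp
  qed
  have apex: "\<exists>\<tau>\<in>?E. \<forall>A\<in>out S. A \<inter> M = \<tau>" if S: "S \<in> wide N" "?P S" for S
  proof -
    have "finite (\<Union>S)" using S(1) N(1) by (auto simp: wide_def intro: finite_subset)
    then have "5 \<le> card (\<Union>S)"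
      using S(1) card_mono[of "\<Union>S" "vary S"] by (auto simp: wide_def vary_def)
    then have "2 \<le> card (\<Union>S - M)" using M diff_card_le_card_Diff[of M "\<Union>S"] by simp
    then obtain i j where ij: "i \<in> \<Union>S - M" "j \<in> \<Union>S - M" "i \<noteq> j" by (rule two_elements_of_card)
    then obtain A B where AB: "A \<in> S" "B \<in> S" "i \<in> A - M" "j \<in> B - M" by blast
    have inout: "C \<in> out S" if "C \<in> S" "k \<in> C - M" for C k
    proof -
      have "C \<notin> ?E" using that(2) M(3) by blast
      then have "odd (card C)" using S(2) that(1) by blast
      then show ?thesis using that by (auto simp: out_def)
    qed
    have out: "A \<in> out S" "B \<in> out S" using inout AB by blast+
    have "C \<inter> M = A \<inter> M" if C: "C \<in> out S" for C
    proof (cases "C - M = A - M")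
      case False then show ?thesis using same[OF S C out(1)] by blast
    next
      case True
      have "A - M \<noteq> B - M"
      proof
        assume "A - M = B - M"
        moreover obtain k where "A - M = {k}" using shape[OF S out(1)] by (metis card_1_singletonE)
        ultimately have "i \<in> {k}" "j \<in> {k}" using AB(3,4) by simp_all
        then show False using ij(3) by simp
      qed
      then have "C \<inter> M = B \<inter> M" "A \<inter> M = B \<inter> M"
        using same[OF S C out(2)] same[OF S out] True by auto
      then show ?thesis by simp
    qed
    then show ?thesis using shape[OF S out(1)] by blast
  qed
  show ?thesis
  proof (rule tower_fibres_empty[where \<phi> = out])
    show "finite {S \<in> wide N. ?P S}" using finite_wide[OF N(1)] by simp
    show "out S \<subseteq> out T" if "S \<subseteq> T" for S T using that by (auto simp: out_def)
    fix S0 assume "S0 \<in> {S \<in> wide N. ?P S}"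
    then obtain \<tau> where \<tau>: "\<tau> \<in> ?E" "\<forall>A\<in>out S0. A \<inter> M = \<tau>" using apex[of S0] by blast
    define v where "v = sdiff {a} \<tau>"
    have v: "v \<subseteq> M" "odd (card v)" using \<tau>(1) abc by (auto simp: v_def sdiff_def M_def insert_Diff_if)
    have "tower {} {S \<in> wide N. ?P S \<and> out S = out S0}"
    proof (rule tower_wide_toggle[OF N(1), of v])
      show "v \<subseteq> N" using v(1) N(2) by (auto simp: M_def)
      fix S
      have "{A\<in>insert v S. even (card A)} = {A\<in>S. even (card A)}" using v(2) by auto
      moreover have "out (insert v S) = out S" using v(1) by (auto simp: out_def)
      ultimately show "(?P (insert v S) \<and> out (insert v S) = out S0) = (?P S \<and> out S = out S0)"
        by (simp only:)
      assume S: "S \<in> wide N" "?P S \<and> out S = out S0"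
      show "\<exists>Z\<subseteq>S - {v}. v \<subseteq> \<Union>Z \<and> \<Inter>Z \<subseteq> v"
      proof (intro exI conjI)
        show "?E \<subseteq> S - {v}" using S(2) v(2) by blast
        show "v \<subseteq> \<Union>?E" using v(1) M(3) by simp
      qed simp
      fix A assume A: "A \<in> S"
      show "card (sdiff v A) \<le> 3"
      proof (cases "A \<subseteq> M")
        case True
        then show ?thesis using v(1) M card_mono[OF M(1), of "sdiff v A"] sdiff_subset[of v M A] by simp
      next
        case False
        then have "A \<notin> ?E" using M(3) by blast
        then have "odd (card A)" using A S(2) by blast
        then have "A \<in> out S" using A False by (simp add: out_def)
        moreover from this have "A \<in> out S0" using S(2) by simp
        ultimately have AM: "A \<inter> M = \<tau>" "card (A - M) = 1"
          using shape[OF S(1) conjunct1[OF S(2)]] \<tau>(2) by simp_all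
        obtain j where "A - M = {j}" using AM(2) by (rule card_1_singletonE)
        then have "A = \<tau> \<union> {j}" "j \<notin> M" using AM(1) by auto
        then have "sdiff v A \<subseteq> {a, j}" by (auto simp: v_def sdiff_def)
        then have "card (sdiff v A) \<le> card {a, j}" by (intro card_mono) simp_all
        also have "\<dots> \<le> 2" by (simp add: card_insert_if)
        finally show ?thesis by simp
      qed
    qed
    then show "tower {} {S' \<in> {S \<in> wide N. ?P S}. out S' = out S0}"
      by (simp add: conj_assoc)
  qed
qed

lemma intersecting_triples_common:
  assumes F: "\<And>A. A \<in> F \<Longrightarrow> card A = 3" "\<And>A B. A \<in> F \<Longrightarrow> B \<in> F \<Longrightarrow> 2 \<le> card (A \<inter> B)"
    and big: "5 \<le> card (\<Union>F)"
  shows "\<exists>i. \<forall>A\<in>F. i \<in> A"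
proof -
  have fin: "finite A" if "A \<in> F" for A using F(1)[OF that] card_ge_0_finite by force
  have ext: "\<exists>B\<in>F. \<not> B \<subseteq> Y" if "finite Y" "card Y < 5" for Y
    using that big card_mono[of Y "\<Union>F"] by (meson Union_least leD le_trans)
  obtain A where A: "A \<in> F" using ext[of "{}"] by auto
  obtain B where B: "B \<in> F" "\<not> B \<subseteq> A" using ext[of A] F(1) fin A by auto
  have "card (B \<inter> A) < card B" using B fin by (intro psubset_card_mono) auto
  then have AB2: "card (A \<inter> B) = 2" using F(1)[OF B(1)] F(2)[OF A B(1)] by (simp add: Int_commute)
  have AB4: "card (A \<union> B) = 4"
    using card_Un_Int[OF fin[OF A] fin[OF B(1)]] F(1)[OF A] F(1)[OF B(1)] AB2 by simp
  obtain C z where C: "C \<in> F" "z \<in> C" "z \<notin> A \<union> B" using ext[of "A \<union> B"] AB4 fin A B by auto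
  have Cz: "card (C - {z}) = 2" using C F(1) by simp
  have "C \<inter> Y = C - {z}" if "Y \<in> F" "z \<notin> Y" for Y
    by (rule card_seteq) (use that C fin F(2)[OF C(1) that(1)] Cz in auto)
  then have "C - {z} \<subseteq> A \<inter> B" using A B C by blast
  then have "C - {z} = A \<inter> B" using Cz AB2 fin A by (intro card_subset_eq) auto
  then obtain p where p: "p \<in> A" "p \<in> B" "p \<in> C" using AB2 by (metis Diff_iff IntE card.empty equals0I zero_neq_numeral)
  have "p \<in> D" if D: "D \<in> F" for D
  proof (rule ccontr)
    assume "p \<notin> D"
    have "Y - {p} \<subseteq> D" if "Y \<in> F" "p \<in> Y" for Y
    proof -
      have "Y \<inter> D = Y - {p}"
        by (rule card_seteq) (use that fin F(1) F(2)[OF that(1) D] \<open>p \<notin> D\<close> in auto)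
      then show ?thesis by blast
    qed
    then have "insert z (A \<union> B) - {p} \<subseteq> D" using A B C p by blast
    moreover have "card (insert z (A \<union> B) - {p}) = 4" using AB4 C p fin A B by simp
    ultimately show False
      using card_mono[OF fin[OF D], of "insert z (A \<union> B) - {p}"] F(1)[OF D] by simp
  qed
  then show ?thesis by blast
qed

lemma tower_apex:
  fixes N :: "'a set"
  assumes N: "finite N"
  shows "tower {} {S \<in> wide N. {A\<in>S. even (card A)} = {{}} \<and> \<not> (\<forall>A\<in>S. card A \<le> 1)}"
proof -
  let ?P = "\<lambda>S :: 'a set set. {A\<in>S. even (card A)} = {{}}"
  define tr where "tr S = {A\<in>S. card A = 3}" for S :: "'a set set"
  note fin = wide_finite_vertex[OF N]
  have size: "card A = 0 \<or> card A = 1 \<or> card A = 3" if S: "S \<in> wide N" "?P S" "A \<in> S" for S A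
  proof (cases "even (card A)")
    case True
    then have "A \<in> {{}}" using S by blast
    then show ?thesis by simp
  next
    case False
    have "{} \<in> S" using S(2) by blast
    then have "card A \<le> 3" using wide_close[OF S(1) _ S(3), of "{}"] by simp
    then show ?thesis using False by presburger
  qed
  have common: "\<exists>i\<in>N. \<forall>A\<in>tr S. i \<in> A" if S: "S \<in> wide N" "?P S" "tr S \<noteq> {}" for S
  proof -
    obtain T where T: "T \<in> S" "card T = 3" using S(3) by (auto simp: tr_def)
    have sub: "\<Union>S \<subseteq> \<Union>(tr S)"
    proof (rule Union_least)
      fix A assume A: "A \<in> S"
      consider "card A = 0" | "card A = 1" | "card A = 3" using size[OF S(1,2) A] by metis
      then show "A \<subseteq> \<Union>(tr S)"
      proof cases
        case 1 then show ?thesis using fin[OF S(1) A] by simp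
      next
        case 2
        then obtain i where i: "A = {i}" by (rule card_1_singletonE)
        have "i \<in> T"
          using wide_close[OF S(1) A T(1)] card_sdiff_singleton[OF fin[OF S(1) T(1)], of i] T(2)
          unfolding i by (cases "i \<in> T") simp_all
        then show ?thesis using T i by (auto simp: tr_def)
      next
        case 3 then show ?thesis using A by (auto simp: tr_def)
      qed
    qed
    have "finite (\<Union>(tr S))" using S(1) N by (auto simp: wide_def tr_def intro: finite_subset)
    then have "5 \<le> card (\<Union>(tr S))"
      using S(1) card_mono[of "\<Union>(tr S)" "vary S"] sub
      by (smt (verit) Diff_subset le_trans mem_Collect_eq subset_trans vary_def wide_def)
    moreover have "2 \<le> card (A \<inter> B)" if "A \<in> tr S" "B \<in> tr S" for A B
      using that card_sdiff[of A B] wide_close[OF S(1), of A B] fin[OF S(1)] by (auto simp: tr_def)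
    ultimately obtain i where i: "\<forall>A\<in>tr S. i \<in> A"
      using intersecting_triples_common[of "tr S"] by (auto simp: tr_def)
    moreover have "i \<in> N" using i T S(1) by (auto simp: tr_def wide_def)
    ultimately show ?thesis by blast
  qed
  show ?thesis
  proof (rule tower_fibres_empty[where \<phi> = tr])
    show "finite {S \<in> wide N. ?P S \<and> \<not> (\<forall>A\<in>S. card A \<le> 1)}" using finite_wide[OF N] by simp
    show "tr S \<subseteq> tr T" if "S \<subseteq> T" for S T using that by (auto simp: tr_def)
    fix S0 assume S0: "S0 \<in> {S \<in> wide N. ?P S \<and> \<not> (\<forall>A\<in>S. card A \<le> 1)}"
    then obtain T where "T \<in> S0" "\<not> card T \<le> 1" by blast
    then have T: "T \<in> tr S0" using size[of S0 T] S0 by (auto simp: tr_def)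
    then obtain i where i: "i \<in> N" "\<forall>A\<in>tr S0. i \<in> A" using common[of S0] S0 by blast
    have "tower {} {S \<in> wide N. ?P S \<and> tr S = tr S0}"
    proof (rule tower_wide_toggle[OF N, of "{i}"])
      fix S
      have "{A\<in>insert {i} S. even (card A)} = {A\<in>S. even (card A)}" by auto
      moreover have "tr (insert {i} S) = tr S" by (auto simp: tr_def)
      ultimately show "(?P (insert {i} S) \<and> tr (insert {i} S) = tr S0) = (?P S \<and> tr S = tr S0)"
        by (simp only:)
      assume S: "S \<in> wide N" "?P S \<and> tr S = tr S0"
      have "T \<in> S" "i \<in> T" "card T = 3" using T S(2) i(2) by (auto simp: tr_def)
      moreover have "{} \<in> S" using S(2) by blast
      ultimately show "\<exists>Z\<subseteq>S - {{i}}. {i} \<subseteq> \<Union>Z \<and> \<Inter>Z \<subseteq> {i}"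
        by (intro exI[of _ "{{}, T}"]) auto
      fix A assume A: "A \<in> S"
      show "card (sdiff {i} A) \<le> 3"
        using size[OF S(1) _ A] S(2) i(2) A card_sdiff_singleton[OF fin[OF S(1) A], of i]
        by (auto simp: tr_def)
    qed (use i in simp)
    moreover have "{S' \<in> {S \<in> wide N. ?P S \<and> \<not> (\<forall>A\<in>S. card A \<le> 1)}. tr S' = tr S0}
        = {S \<in> wide N. ?P S \<and> tr S = tr S0}"
    proof -
      have "\<not> (\<forall>A\<in>S. card A \<le> 1)" if "tr S = tr S0" for S
      proof -
        have "T \<in> S" "card T = 3" using that T by (auto simp: tr_def)
        then show ?thesis by force
      qed
      then show ?thesis by blast
    qed
    ultimately show "tower {} {S' \<in> {S \<in> wide N. ?P S \<and> \<not> (\<forall>A\<in>S. card A \<le> 1)}. tr S' = tr S0}"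
      by (simp only:)
  qed
qed

lemma tower_cone:
  assumes N: "finite N" and Q: "2 \<le> card Q"
  shows "tower {} {S \<in> wide N. {A\<in>S. odd (card A)} = (\<lambda>i. {i}) ` Q \<and> {A\<in>S. even (card A)} \<subseteq> {{}}}"
proof (rule tower_wide_toggle[OF N, of "{}"])
  fix S :: "'a set set"
  have "{A\<in>insert {} S. odd (card A)} = {A\<in>S. odd (card A)}"
    "{A\<in>insert {} S. even (card A)} \<subseteq> {{}} \<longleftrightarrow> {A\<in>S. even (card A)} \<subseteq> {{}}" by auto
  then show "({A\<in>insert {} S. odd (card A)} = (\<lambda>i. {i}) ` Q \<and> {A\<in>insert {} S. even (card A)} \<subseteq> {{}})
      = ({A\<in>S. odd (card A)} = (\<lambda>i. {i}) ` Q \<and> {A\<in>S. even (card A)} \<subseteq> {{}})"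
    by (simp only:)
  assume S: "{A\<in>S. odd (card A)} = (\<lambda>i. {i}) ` Q \<and> {A\<in>S. even (card A)} \<subseteq> {{}}"
  show "\<exists>Z\<subseteq>S - {{}}. {} \<subseteq> \<Union>Z \<and> \<Inter>Z \<subseteq> {}"
  proof (intro exI conjI)
    show "(\<lambda>i. {i}) ` Q \<subseteq> S - {{}}" using S by blast
    obtain i j where "i \<in> Q" "j \<in> Q" "i \<noteq> j" using Q by (rule two_elements_of_card)
    then show "\<Inter>((\<lambda>i. {i}) ` Q) \<subseteq> {}" by auto
  qed simp
  fix A assume A: "A \<in> S"
  have "A \<in> (\<lambda>i. {i}) ` Q" if "odd (card A)" using S A that by blast
  moreover have "A = {}" if "even (card A)" using S A that by blast
  ultimately have "card A \<le> 1" by (cases "even (card A)") auto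
  then show "card (sdiff {} A) \<le> 3" by simp
qed simp

lemma intersecting_pairs:
  assumes F: "\<And>A. A \<in> F \<Longrightarrow> card A = 2" "\<And>A B. A \<in> F \<Longrightarrow> B \<in> F \<Longrightarrow> A \<inter> B \<noteq> {}" and "F \<noteq> {}"
  obtains i where "\<And>A. A \<in> F \<Longrightarrow> i \<in> A"
  | a b c where "distinct [a, b, c]" "F = {{a, b}, {a, c}, {b, c}}"
proof (cases "\<exists>i. \<forall>A\<in>F. i \<in> A")
  case True then show ?thesis using that(1) by blast
next
  case False
  obtain A where A: "A \<in> F" using \<open>F \<noteq> {}\<close> by blast
  obtain a b where ab: "A = {a, b}" "a \<noteq> b" using F(1)[OF A] by (auto simp: card_2_iff)
  obtain B where B: "B \<in> F" "a \<notin> B" using False by blast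
  have "b \<in> B" using F(2)[OF A B(1)] B(2) ab by blast
  obtain c where c: "B = {b, c}" "b \<noteq> c" using F(1)[OF B(1)] \<open>b \<in> B\<close> by (auto simp: card_2_iff)
  obtain C where C: "C \<in> F" "b \<notin> C" using False by blast
  have "a \<in> C" using F(2)[OF A C(1)] C(2) ab by blast
  moreover have "c \<in> C" using F(2)[OF B(1) C(1)] C(2) c by blast
  moreover have "a \<noteq> c" using B(2) c by blast
  ultimately have Cac: "C = {a, c}"
    using F(1)[OF C(1)] card_subset_eq[of C "{a, c}"] card_ge_0_finite[of C] by auto
  have "D \<in> {{a, b}, {a, c}, {b, c}}" if D: "D \<in> F" for D
  proof -
    obtain x y where xy: "D = {x, y}" "x \<noteq> y" using F(1)[OF D] by (auto simp: card_2_iff)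
    have "{x, y} \<inter> {a, b} \<noteq> {}" "{x, y} \<inter> {b, c} \<noteq> {}" "{x, y} \<inter> {a, c} \<noteq> {}"
      using F(2)[OF D A] F(2)[OF D B(1)] F(2)[OF D C(1)] xy ab c Cac by simp_all
    then show ?thesis unfolding xy using xy(2) ab(2) c(2) \<open>a \<noteq> c\<close> by (auto simp: doubleton_eq_iff)
  qed
  then have "F = {{a, b}, {a, c}, {b, c}}" using A B C ab c Cac by blast
  then show ?thesis using that(2)[of a b c] ab c \<open>a \<noteq> c\<close> by simp
qed

lemma same_parity_clique:
  assumes N: "finite N" "E \<subseteq> Pow N" and cl: "clique E"
    and par: "\<And>A B. A \<in> E \<Longrightarrow> B \<in> E \<Longrightarrow> even (card A) \<longleftrightarrow> even (card B)" and two: "2 \<le> card E"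
  obtains w Q where "w \<subseteq> N" "Q \<subseteq> N" "2 \<le> card Q" "sdiff w ` E = (\<lambda>i. {i}) ` Q"
  | w a b c where "w \<subseteq> N" "{a, b, c} \<subseteq> N" "distinct [a, b, c]" "sdiff w ` E = {{}, {a, b}, {a, c}, {b, c}}"
proof -
  obtain e e' where e: "e \<in> E" "e' \<in> E" "e \<noteq> e'" using two by (rule two_elements_of_card)
  define F where "F = sdiff e ` E - {{}}"
  have fin: "finite A" if "A \<in> E" for A using that N by (auto intro: finite_subset)
  have inj: "inj_on (sdiff w) A" for w :: "'a set" and A by (rule inj_on_inverseI[of _ "sdiff w"]) simp
  have dist: "card (sdiff A B) = 2" if "A \<in> E" "B \<in> E" "A \<noteq> B" for A B
  proof -
    have "card (sdiff A B) \<le> 3" using cl that by (auto simp: clique_def)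
    moreover have "even (card (sdiff A B))"
      using par[OF that(1,2)] even_card_sdiff[OF fin[OF that(1)] fin[OF that(2)]] by blast
    moreover have "sdiff A B \<noteq> {}" using that(3) by (auto simp: sdiff_def)
    then have "card (sdiff A B) \<noteq> 0" using fin[OF that(1)] fin[OF that(2)] by (simp add: sdiff_def)
    ultimately show ?thesis by presburger
  qed
  have FN: "A \<subseteq> N" if "A \<in> F" for A using that N e by (auto simp: F_def sdiff_def)
  have FE: "sdiff e ` E = insert {} F" using e(1) by (force simp: F_def)
  have F2: "card A = 2" if A: "A \<in> F" for A
  proof -
    obtain B where "A = sdiff e B" "B \<in> E" using A by (auto simp: F_def)
    moreover from this have "e \<noteq> B" using A by (auto simp: F_def)
    ultimately show ?thesis using dist e(1) by blast
  qed
  have Fint: "A \<inter> B \<noteq> {}" if AB: "A \<in> F" "B \<in> F" for A B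
  proof
    assume disj: "A \<inter> B = {}"
    obtain A' B' where AB': "A = sdiff e A'" "A' \<in> E" "B = sdiff e B'" "B' \<in> E" using AB by (auto simp: F_def)
    have "A \<noteq> B" using disj F2[OF AB(1)] by auto
    then have "A' \<noteq> B'" using AB' by blast
    then have "card (sdiff A B) = 2" using dist[of A' B'] AB' by simp
    moreover have "finite A" "finite B" using FN AB N(1) by (auto intro: finite_subset)
    ultimately show False using card_sdiff[of A B] F2 AB disj by simp
  qed
  have "sdiff e e' \<noteq> {}" using e(3) by (auto simp: sdiff_def)
  then have "F \<noteq> {}" using e(2) by (auto simp: F_def)
  from F2 Fint this show ?thesis
  proof (rule intersecting_pairs)
    fix i assume i: "\<And>A. A \<in> F \<Longrightarrow> i \<in> A"
    define w where "w = sdiff e {i}"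
    define Q where "Q = {j. {j} \<in> sdiff w ` E}"
    have iN: "i \<in> N" using i FN \<open>F \<noteq> {}\<close> by blast
    have wN: "w \<subseteq> N" using iN e(1) N by (auto simp: w_def sdiff_def)
    have single: "card A = 1" if AE: "A \<in> sdiff w ` E" for A
    proof -
      obtain B where B: "B \<in> E" "A = sdiff w B" using AE by blast
      have A: "A = sdiff {i} (sdiff e B)" unfolding B(2) w_def by (auto simp: sdiff_def)
      show ?thesis
      proof (cases "sdiff e B = {}")
        case True then show ?thesis using A by simp
      next
        case False
        then have "sdiff e B \<in> F" using B by (auto simp: F_def)
        moreover have "finite (sdiff e B)" using e B fin by (auto simp: sdiff_def)
        ultimately show ?thesis using A F2 i card_sdiff_singleton[of "sdiff e B" i] by simp
      qed
    qed
    have "sdiff w ` E = (\<lambda>i. {i}) ` Q"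
    proof
      show "sdiff w ` E \<subseteq> (\<lambda>i. {i}) ` Q"
      proof
        fix A assume A: "A \<in> sdiff w ` E"
        then obtain j where "A = {j}" using single card_1_singletonE by metis
        then show "A \<in> (\<lambda>i. {i}) ` Q" using A by (auto simp: Q_def)
      qed
    qed (auto simp: Q_def)
    moreover have "card Q = card E"
    proof -
      have "card (sdiff w ` E) = card E" using inj by (rule card_image)
      moreover have "card ((\<lambda>i. {i}) ` Q) = card Q" by (rule card_image) simp
      ultimately show ?thesis using \<open>sdiff w ` E = (\<lambda>i. {i}) ` Q\<close> by simp
    qed
    moreover have "Q \<subseteq> N"
    proof
      fix j assume "j \<in> Q"
      then obtain B where "B \<in> E" "{j} = sdiff w B" by (auto simp: Q_def)
      then have "{j} \<subseteq> N" using sdiff_subset[of w N B] wN N(2) by auto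
      then show "j \<in> N" by simp
    qed
    ultimately show ?thesis using that(1)[OF wN] two by simp
  next
    fix a b c assume abc: "distinct [a, b, c]" "F = {{a, b}, {a, c}, {b, c}}"
    then have "{a, b, c} \<subseteq> N" using FN by auto
    then show ?thesis using that(2)[of e a b c] abc FE e(1) N(2) by auto
  qed
qed

lemma parity_translate:
  assumes N: "finite N" "w \<subseteq> N" and E: "E \<subseteq> Pow N" "\<And>A. A \<in> sdiff w ` E \<Longrightarrow> even (card A) = q"
    "E \<noteq> {}" "\<And>A. A \<in> E \<Longrightarrow> even (card A) = p" and S: "S \<in> wide N"
  shows "{A \<in> sdiff w ` S. even (card A) = p} = E \<longleftrightarrow> {A \<in> S. even (card A) = q} = sdiff w ` E"
proof -
  have fin: "finite A" if "A \<subseteq> N" for A using that N(1) finite_subset by blast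
  have par: "even (card (sdiff w A)) \<longleftrightarrow> (even (card w) \<longleftrightarrow> even (card A))" if "A \<subseteq> N" for A
    using that N(2) fin by (simp add: even_card_sdiff)
  obtain e where "e \<in> E" using E(3) by blast
  then have q: "q \<longleftrightarrow> (even (card w) \<longleftrightarrow> p)" using E par[of e] by blast
  have "{A \<in> sdiff w ` S. even (card A) = p} = sdiff w ` {A \<in> S. even (card A) = q}"
    using par S q by (auto simp: wide_def)
  moreover have "inj (sdiff w)" by (rule inj_on_inverseI[of _ "sdiff w"]) simp
  ultimately show ?thesis
    using inj_image_eq_iff[of "sdiff w" "{A \<in> S. even (card A) = q}" "sdiff w ` E"] by simp
qed

definition evens :: "'a set set \<Rightarrow> 'a set set" where
  "evens S = {A\<in>S. even (card A)}"

definition odds :: "'a set set \<Rightarrow> 'a set set" where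
  "odds S = {A\<in>S. odd (card A)}"

definition starlike :: "'a set set \<Rightarrow> bool" where
  "starlike S \<longleftrightarrow> evens S = {} \<or> (\<exists>a. evens S = {a} \<and> (\<forall>A\<in>S. card (sdiff a A) \<le> 1))"

lemma starlike_subset:
  assumes "starlike T" "S \<subseteq> T" shows "starlike S"
proof -
  have "evens S \<subseteq> evens T" using assms(2) by (auto simp: evens_def)
  then show ?thesis using assms unfolding starlike_def by (metis subset_iff subset_singletonD subset_empty)
qed

lemma evens_translate:
  assumes "finite N" "w \<subseteq> N" "even (card w)" "S \<subseteq> Pow N"
  shows "evens (sdiff w ` S) = sdiff w ` evens S"
proof -
  have "even (card (sdiff w A)) \<longleftrightarrow> even (card A)" if "A \<in> S" for A
    using that assms even_card_sdiff[of w A] finite_subset[of _ N] by auto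
  then show ?thesis by (auto simp: evens_def)
qed

lemma starlike_translate:
  assumes "finite N" "w \<subseteq> N" "even (card w)" "S \<subseteq> Pow N"
  shows "starlike (sdiff w ` S) \<longleftrightarrow> starlike S"
proof -
  have dir: "starlike (sdiff w ` S)" if S: "starlike S" "S \<subseteq> Pow N" for S
  proof -
    have ev: "evens (sdiff w ` S) = sdiff w ` evens S" by (rule evens_translate) (use assms S in auto)
    show ?thesis
    proof (cases "evens S = {}")
      case True then show ?thesis using ev by (simp add: starlike_def)
    next
      case False
      then obtain a where a: "evens S = {a}" "\<forall>A\<in>S. card (sdiff a A) \<le> 1"
        using S(1) by (auto simp: starlike_def)
      then have "evens (sdiff w ` S) = {sdiff w a}" "\<forall>A\<in>sdiff w ` S. card (sdiff (sdiff w a) A) \<le> 1"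
        using ev by auto
      then show ?thesis unfolding starlike_def by blast
    qed
  qed
  have "sdiff w ` S \<subseteq> Pow N" using assms(2,4) by (auto simp: sdiff_def)
  then show ?thesis using dir[of S] dir[of "sdiff w ` S"] assms(4) by auto
qed

lemma singletons_of_card_1:
  assumes "\<And>A. A \<in> S \<Longrightarrow> card A = 1"
  shows "S = (\<lambda>i. {i}) ` \<Union>S"
proof -
  have "A \<in> (\<lambda>i. {i}) ` \<Union>S" if A: "A \<in> S" for A
  proof -
    obtain j where "A = {j}" using assms[OF A] by (rule card_1_singletonE)
    then show ?thesis using A by blast
  qed
  moreover have "{i} \<in> S" if i: "i \<in> \<Union>S" for i
  proof -
    obtain A where A: "A \<in> S" "i \<in> A" using i by blast
    then show ?thesis using assms[OF A(1)] card_1_singletonE[of A] by (metis singletonD)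
  qed
  ultimately show ?thesis by blast
qed

lemma starlike_center:
  fixes N :: "'a set"
  assumes N: "finite N" and S: "S \<in> wide N" "starlike S"
  obtains w Q where "w \<subseteq> N" "even (card w)" "5 \<le> card Q" "sdiff w ` odds S = (\<lambda>i. {i}) ` Q"
proof (cases "evens S = {}")
  case True
  then have odd: "odds S = S" by (auto simp: evens_def odds_def)
  have SN: "S \<subseteq> Pow N" "clique S" "5 \<le> card (vary S)" using S(1) by (auto simp: wide_def)
  have fS: "finite S" using SN(1) N finite_subset by blast
  have two: "2 \<le> card S"
  proof (rule ccontr)
    assume "\<not> 2 \<le> card S"
    then have "card S = 0 \<or> card S = 1" by linarith
    then have "S = {} \<or> (\<exists>x. S = {x})" using fS by (metis card_0_eq card_1_singletonE)
    then have "vary S = {}" by (auto simp: vary_def)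
    then show False using SN(3) by simp
  qed
  have par: "even (card A) \<longleftrightarrow> even (card B)" if "A \<in> S" "B \<in> S" for A B
    using that True by (auto simp: evens_def)
  from N SN(1,2) par two show ?thesis
  proof (rule same_parity_clique)
    fix w Q assume w: "w \<subseteq> N" "Q \<subseteq> N" "2 \<le> card Q" "sdiff w ` S = (\<lambda>i. {i}) ` Q"
    have fQ: "finite Q" using w(2) N finite_subset by blast
    have "vary ((\<lambda>i. {i}) ` Q) \<subseteq> Q" by (auto simp: vary_def)
    then have "card (vary (sdiff w ` S)) \<le> card Q" using card_mono[OF fQ] w(4) by simp
    then have "5 \<le> card Q" using SN(3) by simp
    moreover have "even (card w)"
    proof -
      obtain i where "i \<in> Q" using w(3) by fastforce
      then obtain A where A: "A \<in> S" "{i} = sdiff w A" using w(4) by (metis imageE imageI)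
      have "finite w" "finite A" using w(1) A(1) SN(1) N finite_subset by blast+
      then have "even (card {i}) \<longleftrightarrow> (even (card w) \<longleftrightarrow> even (card A))" unfolding A(2) by (rule even_card_sdiff)
      then show ?thesis using A(1) True by (auto simp: evens_def)
    qed
    ultimately show ?thesis using that w odd by metis
  next
    fix w a b c assume "sdiff w ` S = {{}, {a, b}, {a, c}, {b, c}}"
    then have "vary (sdiff w ` S) \<subseteq> {a, b, c}" by (auto simp: vary_def)
    then have "card (vary S) \<le> card {a, b, c}" using card_mono[of "{a, b, c}" "vary S"] by simp
    also have "\<dots> \<le> 3" by (simp add: card_insert_if)
    finally show ?thesis using SN(3) by simp
  qed
next
  case False
  then obtain a where a: "evens S = {a}" "\<forall>A\<in>S. card (sdiff a A) \<le> 1" using S(2) by (auto simp: starlike_def)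
  have SN: "S \<subseteq> Pow N" "5 \<le> card (vary S)" using S(1) by (auto simp: wide_def)
  have fin: "finite A" if "A \<in> S" for A using that SN N finite_subset by blast
  have aS: "a \<in> S" "even (card a)" using a(1) by (auto simp: evens_def)
  define Q where "Q = \<Union>(sdiff a ` odds S)"
  have "card A = 1" if A: "A \<in> sdiff a ` odds S" for A
  proof -
    obtain B where B: "B \<in> S" "odd (card B)" "A = sdiff a B" using A by (auto simp: odds_def)
    have "odd (card A)" unfolding B(3) using even_card_sdiff[OF fin[OF aS(1)] fin[OF B(1)]] aS(2) B(2) by blast
    moreover have "card A \<le> 1" using a(2) B by blast
    ultimately show ?thesis by presburger
  qed
  then have sing: "sdiff a ` odds S = (\<lambda>i. {i}) ` Q" unfolding Q_def by (rule singletons_of_card_1)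
  have "S = insert a (odds S)" using a(1) by (auto simp: evens_def odds_def)
  then have "sdiff a ` S = insert {} (sdiff a ` odds S)" by (metis image_insert sdiff_self)
  then have "vary S = Q" using vary_translate[of a S] by (simp add: vary_def Q_def)
  then show ?thesis using that[of a Q] aS SN sing by auto
qed

lemma starlike_over_singletons:
  assumes N: "finite N" and S: "S \<in> wide N" "odds S = (\<lambda>i. {i}) ` Q" and Q: "5 \<le> card Q"
  shows "starlike S \<longleftrightarrow> evens S \<subseteq> {{}}"
proof
  assume "starlike S"
  then consider "evens S = {}" | a where "evens S = {a}" "\<forall>A\<in>S. card (sdiff a A) \<le> 1"
    by (auto simp: starlike_def)
  then show "evens S \<subseteq> {{}}"
  proof cases
    case 2
    have "a \<in> S" using 2(1) by (auto simp: evens_def)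
    then have fa: "finite a" using S(1) N by (auto simp: wide_def intro: finite_subset)
    have near: "card (sdiff {i} a) \<le> 1" if "i \<in> Q" for i
    proof -
      have "{i} \<in> odds S" using S(2) that by blast
      then have "{i} \<in> S" by (simp add: odds_def)
      then show ?thesis using 2(2) sdiff_commute[of a "{i}"] by metis
    qed
    have "card a = 0"
    proof (rule ccontr)
      assume "card a \<noteq> 0"
      have "i \<in> a \<and> card a \<le> 2" if "i \<in> Q" for i
        using near[OF that] card_sdiff_singleton[OF fa, of i] \<open>card a \<noteq> 0\<close> by (cases "i \<in> a") simp_all
      moreover obtain i where "i \<in> Q" using Q by fastforce
      ultimately have "Q \<subseteq> a" "card a \<le> 2" by blast+
      then show False using Q card_mono[OF fa, of Q] by simp
    qed
    then show ?thesis using 2(1) fa by simp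
  qed simp
next
  assume ev: "evens S \<subseteq> {{}}"
  have "card (sdiff {} A) \<le> 1" if "A \<in> S" for A
  proof (cases "even (card A)")
    case True
    then have "A \<in> {{}}" using that ev by (auto simp: evens_def)
    then show ?thesis by simp
  next
    case False
    then have "A \<in> (\<lambda>i. {i}) ` Q" using that S(2) by (auto simp: odds_def)
    then show ?thesis by auto
  qed
  then show "starlike S" using ev unfolding starlike_def by blast
qed

lemma tower_starlike:
  fixes N :: "'a set"
  assumes N: "finite N"
  shows "tower {} {S \<in> wide N. starlike S}"
proof (rule tower_fibres_empty[where \<phi> = odds])
  show "finite {S \<in> wide N. starlike S}" using finite_wide[OF N] by simp
  show "odds S \<subseteq> odds T" if "S \<subseteq> T" for S T :: "'a set set" using that by (auto simp: odds_def)
  fix S0 assume "S0 \<in> {S \<in> wide N. starlike S}"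
  then have S0: "S0 \<in> wide N" "starlike S0" by simp_all
  obtain w Q where w: "w \<subseteq> N" "even (card w)" "5 \<le> card Q" "sdiff w ` odds S0 = (\<lambda>i. {i}) ` Q"
    using starlike_center[OF N S0] .
  have odd0: "{A\<in>sdiff w ` S. odd (card A)} = odds S0 \<longleftrightarrow> odds S = (\<lambda>i. {i}) ` Q" if "S \<in> wide N" for S
  proof -
    have "odds S0 \<noteq> {}" using w(3,4) by auto
    moreover have "odds S0 \<subseteq> Pow N" using S0(1) by (auto simp: wide_def odds_def)
    moreover have "even (card A) = False" if "A \<in> sdiff w ` odds S0" for A using that unfolding w(4) by auto
    moreover have "even (card A) = False" if "A \<in> odds S0" for A using that by (simp add: odds_def)
    ultimately have "{A\<in>sdiff w ` S. even (card A) = False} = odds S0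
        \<longleftrightarrow> {A\<in>S. even (card A) = False} = sdiff w ` odds S0"
      using that by (intro parity_translate[OF N w(1)])
    then show ?thesis unfolding w(4) by (simp add: odds_def[of S])
  qed
  have "tower {} {S \<in> wide N. starlike S \<and> {A\<in>S. odd (card A)} = odds S0}"
  proof (rule tower_translate[OF w(1)])
    have "{S \<in> wide N. starlike (sdiff w ` S) \<and> {A \<in> sdiff w ` S. odd (card A)} = odds S0}
        = {S \<in> wide N. odds S = (\<lambda>i. {i}) ` Q \<and> evens S \<subseteq> {{}}}"
      using odd0 starlike_translate[OF N w(1,2)] starlike_over_singletons[OF N _ _ w(3)]
      by (auto simp: wide_def)
    then show "tower {} {S \<in> wide N. starlike (sdiff w ` S) \<and> {A \<in> sdiff w ` S. odd (card A)} = odds S0}"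
      using tower_cone[OF N, of Q] w(3) by (simp add: evens_def odds_def)
  qed
  then show "tower {} {S' \<in> {S \<in> wide N. starlike S}. odds S' = odds S0}"
    by (simp add: odds_def conj_assoc)
qed

lemma tower_wide:
  fixes N :: "'a set"
  assumes N: "finite N"
  shows "tower {} (wide N)"
proof (rule tower_fibres_empty[where \<phi> = "\<lambda>S. if starlike S then {} else evens S"])
  show "finite (wide N)" using finite_wide[OF N] .
  show "(if starlike S then {} else evens S) \<subseteq> (if starlike T then {} else evens T)" if "S \<subseteq> T" for S T :: "'a set set"
    using that starlike_subset[of T S] by (auto simp: evens_def)
  fix S0 assume S0: "S0 \<in> wide N"
  have ne: "evens S \<noteq> {}" if "\<not> starlike S" for S :: "'a set set" using that by (auto simp: starlike_def)
  show "tower {} {S \<in> wide N. (if starlike S then {} else evens S) = (if starlike S0 then {} else evens S0)}"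
  proof (cases "starlike S0")
    case True
    then have "{S \<in> wide N. (if starlike S then {} else evens S) = (if starlike S0 then {} else evens S0)}
        = {S \<in> wide N. starlike S}" using ne by auto
    then show ?thesis using tower_starlike[OF N] by simp
  next
    case False
    define E where "E = evens S0"
    have E: "E \<noteq> {}" "E \<subseteq> Pow N" "clique E" "finite E"
      using ne[OF False] S0 clique_subset[of S0 E] N
      by (auto simp: E_def evens_def wide_def intro: finite_subset[of _ "Pow N"])
    have par: "even (card A) \<longleftrightarrow> even (card B)" if "A \<in> E" "B \<in> E" for A B
      using that by (auto simp: E_def evens_def)
    have fib: "{S \<in> wide N. (if starlike S then {} else evens S) = (if starlike S0 then {} else evens S0)}
        = {S \<in> wide N. evens S = E \<and> \<not> starlike S}"
      using False E(1) by (auto simp: E_def)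
    show ?thesis
    proof (cases "2 \<le> card E")
      case True
      have "\<not> starlike S" if "evens S = E" for S
        using that True E(1) by (auto simp: starlike_def)
      then have fib2: "{S \<in> wide N. evens S = E \<and> \<not> starlike S} = {S \<in> wide N. evens S = E}" by blast
      have transl: "evens (sdiff w ` S) = E \<longleftrightarrow> {A \<in> S. even (card A) = q} = sdiff w ` E"
        if "w \<subseteq> N" "S \<in> wide N" "\<And>A. A \<in> sdiff w ` E \<Longrightarrow> even (card A) = q" for w S q
      proof -
        have "even (card A) = True" if "A \<in> E" for A using that by (simp add: E_def evens_def)
        from parity_translate[OF N that(1) E(2) that(3) E(1) this that(2)]
        show ?thesis by (simp add: evens_def[of "sdiff w ` S"])
      qed
      have "tower {} {S \<in> wide N. evens S = E}"
        using N E(2,3) par True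
      proof (rule same_parity_clique)
        fix w Q assume w: "w \<subseteq> N" "Q \<subseteq> N" "2 \<le> card Q" "sdiff w ` E = (\<lambda>i. {i}) ` Q"
        have "evens (sdiff w ` S) = E \<longleftrightarrow> {A\<in>S. odd (card A)} = (\<lambda>i. {i}) ` Q" if "S \<in> wide N" for S
        proof -
          have "even (card A) = False" if "A \<in> sdiff w ` E" for A using that unfolding w(4) by auto
          from transl[OF w(1) that this] show ?thesis by (simp add: w(4))
        qed
        then have "{S \<in> wide N. evens (sdiff w ` S) = E} = {S \<in> wide N. {A\<in>S. odd (card A)} = (\<lambda>i. {i}) ` Q}"
          by blast
        then show ?thesis using tower_translate[OF w(1)] tower_star[OF N w(2,3)] by simp
      next
        fix w a b c
        assume w: "w \<subseteq> N" "{a, b, c} \<subseteq> N" "distinct [a, b, c]" "sdiff w ` E = {{}, {a, b}, {a, c}, {b, c}}"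
        have "evens (sdiff w ` S) = E \<longleftrightarrow> {A\<in>S. even (card A)} = {{}, {a, b}, {a, c}, {b, c}}"
          if "S \<in> wide N" for S
        proof -
          have "even (card A) = True" if "A \<in> sdiff w ` E" for A using that w(3) unfolding w(4) by auto
          from transl[OF w(1) that this] show ?thesis by (simp add: w(4))
        qed
        then have "{S \<in> wide N. evens (sdiff w ` S) = E}
            = {S \<in> wide N. {A\<in>S. even (card A)} = {{}, {a, b}, {a, c}, {b, c}}}"
          by blast
        then show ?thesis using tower_translate[OF w(1)] tower_tetrahedron[OF N w(2,3)] by simp
      qed
      then show ?thesis unfolding fib fib2 .
    next
      case False
      have "card E \<noteq> 0" using E(1,4) by simp
      then have "card E = 1" using False by linarith
      then obtain a where a: "E = {a}" by (rule card_1_singletonE)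
      have aN: "a \<subseteq> N" "even (card a)" using a E(2) by (auto simp: E_def evens_def)
      have "{S \<in> wide N. evens (sdiff a ` S) = E \<and> \<not> starlike (sdiff a ` S)}
          = {S \<in> wide N. evens S = {{}} \<and> \<not> (\<forall>A\<in>S. card A \<le> 1)}"
      proof -
        have "evens (sdiff a ` S) = E \<longleftrightarrow> evens S = {{}}" if S: "S \<in> wide N" for S
        proof -
          have "evens (sdiff a ` S) = sdiff a ` evens S"
            by (rule evens_translate[OF N aN]) (use S in \<open>simp add: wide_def\<close>)
          moreover have "inj (sdiff a)" by (rule inj_on_inverseI[of _ "sdiff a"]) simp
          then have "sdiff a ` evens S = sdiff a ` {{}} \<longleftrightarrow> evens S = {{}}" by (rule inj_image_eq_iff)
          ultimately show ?thesis using a by simp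
        qed
        moreover have "starlike (sdiff a ` S) \<longleftrightarrow> (\<forall>A\<in>S. card A \<le> 1)" if S: "S \<in> wide N" "evens S = {{}}" for S
        proof -
          have "starlike (sdiff a ` S) \<longleftrightarrow> starlike S"
            by (rule starlike_translate[OF N aN]) (use S in \<open>simp add: wide_def\<close>)
          then show ?thesis using S(2) by (auto simp: starlike_def)
        qed
        ultimately have "S \<in> wide N \<and> evens (sdiff a ` S) = E \<and> \<not> starlike (sdiff a ` S)
            \<longleftrightarrow> S \<in> wide N \<and> evens S = {{}} \<and> \<not> (\<forall>A\<in>S. card A \<le> 1)" for S
          by metis
        then show ?thesis by simp
      qed
      moreover have "tower {} {S \<in> wide N. evens S = {{}} \<and> \<not> (\<forall>A\<in>S. card A \<le> 1)}"
        using tower_apex[OF N] by (simp add: evens_def)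
      ultimately have "tower {} {S \<in> wide N. evens (sdiff a ` S) = E \<and> \<not> starlike (sdiff a ` S)}"
        by (simp only:)
      then show ?thesis
        unfolding fib by (rule tower_translate[OF aN(1)])
    qed
  qed
qed

section \<open>Cliques varying in at most four directions\<close>

lemma vary_mono: "S \<subseteq> T \<Longrightarrow> vary S \<subseteq> vary T"
  by (auto simp: vary_def)

definition lowered :: "'a set \<Rightarrow> 'a set set set" where
  "lowered M = {S. {} \<notin> S \<and> S \<noteq> {} \<and> \<Inter>S = {} \<and> \<Union>S \<subset> M}"

lemma tower_insert_lowered:
  assumes "tower {} (lowered M)"
  shows "tower {} {S. M \<in> S \<and> {} \<notin> S \<and> \<Inter>S = {} \<and> \<Union>S = M \<and> \<Union>(S - {M}) \<noteq> M}"
proof -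
  have "{S. M \<in> S \<and> {} \<notin> S \<and> \<Inter>S = {} \<and> \<Union>S = M \<and> \<Union>(S - {M}) \<noteq> M} = insert M ` lowered M"
  proof (intro equalityI subsetI)
    fix S assume "S \<in> {S. M \<in> S \<and> {} \<notin> S \<and> \<Inter>S = {} \<and> \<Union>S = M \<and> \<Union>(S - {M}) \<noteq> M}"
    then have S: "M \<in> S" "{} \<notin> S" "\<Inter>S = {}" "\<Union>S = M" "\<Union>(S - {M}) \<noteq> M" by auto
    have ne: "S - {M} \<noteq> {}"
    proof
      assume "S - {M} = {}"
      then have "S = {M}" using S(1) by blast
      then show False using S(2,3) by simp
    qed
    have sub: "\<Inter>(S - {M}) \<subseteq> M" using ne S(4) by blast
    have "\<Inter>S = M \<inter> \<Inter>(S - {M})" using S(1) by blast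
    then have "\<Inter>(S - {M}) = {}" using sub S(3) by (simp add: Int_absorb1)
    then have "S - {M} \<in> lowered M" using S ne by (auto simp: lowered_def)
    moreover have "S = insert M (S - {M})" using S(1) by blast
    ultimately show "S \<in> insert M ` lowered M" by blast
  next
    fix S assume "S \<in> insert M ` lowered M"
    then obtain T where T: "S = insert M T" "T \<in> lowered M" by blast
    then have "M \<notin> T" "M \<noteq> {}" by (auto simp: lowered_def)
    then have "S - {M} = T" using T(1) by blast
    then show "S \<in> {S. M \<in> S \<and> {} \<notin> S \<and> \<Inter>S = {} \<and> \<Union>S = M \<and> \<Union>(S - {M}) \<noteq> M}"
      using T \<open>M \<noteq> {}\<close> by (auto simp: lowered_def)
  qed
  moreover have "tower {} (insert M ` lowered M)"
    by (rule tower_insert_vertex[OF assms refl]) (auto simp: lowered_def)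
  ultimately show ?thesis by (simp only:)
qed

lemma tower_lowered:
  assumes "finite M" shows "tower {} (lowered M)"
  using assms
proof (induction rule: finite_psubset_induct)
  case (psubset M)
  have fin: "finite (lowered M)"
    by (rule finite_subset[of _ "Pow (Pow M)"]) (use psubset(1) in \<open>auto simp: lowered_def\<close>)
  show ?case
  proof (rule tower_fibres_empty[where \<phi> = Union, OF fin])
    show "\<Union>S \<subseteq> \<Union>T" if "S \<subseteq> T" for S T :: "'a set set" using that by blast
    fix S0 assume S0: "S0 \<in> lowered M"
    define N where "N = \<Union>S0"
    have N: "N \<subset> M" "N \<noteq> {}" using S0 by (auto simp: N_def lowered_def)
    let ?F = "{S. {} \<notin> S \<and> \<Inter>S = {} \<and> \<Union>S = N}"
    have fib: "{S \<in> lowered M. \<Union>S = \<Union>S0} = ?F"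
    proof -
      have "S \<noteq> {}" if "\<Union>S = N" for S using that N(2) by auto
      then show ?thesis using N(1) unfolding lowered_def N_def[symmetric] by blast
    qed
    have fF: "finite ?F" using fin fib by (metis (no_types, lifting) finite_subset mem_Collect_eq subsetI)
    define matched where "matched S \<longleftrightarrow> \<not> (N \<in> S \<and> \<Union>(S - {N}) \<noteq> N)" for S
    have "tower {} ?F"
    proof (rule tower_fibres_empty[where \<phi> = matched, OF fF])
      fix S T assume "S \<in> ?F" "T \<in> ?F" "S \<subseteq> T"
      then show "matched S \<le> matched T" unfolding matched_def by (simp add: le_bool_def) blast
    next
      fix S1 assume "S1 \<in> ?F"
      have "tower {} {S \<in> ?F. matched S = b}" for b
      proof (cases b)
        case False
        then have "{S \<in> ?F. matched S = b} = {S. N \<in> S \<and> {} \<notin> S \<and> \<Inter>S = {} \<and> \<Union>S = N \<and> \<Union>(S - {N}) \<noteq> N}"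
          by (auto simp: matched_def)
        then show ?thesis using tower_insert_lowered[OF psubset(2)[OF N(1)]] by simp
      next
        case True
        show ?thesis
        proof (rule tower_toggle[of _ N])
          show "finite {S \<in> ?F. matched S = b}" by (rule finite_subset[OF _ fF]) blast
        next
          fix S assume "S \<in> {S \<in> ?F. matched S = b}"
          then have S: "{} \<notin> S" "\<Inter>S = {}" "\<Union>S = N" "N \<in> S \<Longrightarrow> \<Union>(S - {N}) = N"
            using True by (auto simp: matched_def)
          have "\<Union>(insert N S - {N}) = N"
          proof (cases "N \<in> S")
            case True then show ?thesis using S(4) by (simp add: insert_absorb)
          next
            case False then show ?thesis using S(3) by simp
          qed
          then show "insert N S \<in> {S \<in> ?F. matched S = b}"
            using S(1-3) N(2) True by (auto simp: matched_def)
          have U: "\<Union>(S - {N}) = N" using S(3,4) by (cases "N \<in> S") auto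
          then have "S - {N} \<noteq> {}" using N(2) by auto
          then have "\<Inter>(S - {N}) \<subseteq> N" using U by blast
          moreover have "N \<inter> \<Inter>(S - {N}) \<subseteq> \<Inter>S" by blast
          ultimately have "\<Inter>(S - {N}) = {}" using S(2) by (simp add: Int_absorb1)
          then show "S - {N} \<in> {S \<in> ?F. matched S = b}"
            using S(1) U True by (auto simp: matched_def)
        qed
      qed
      then show "tower {} {S' \<in> ?F. matched S' = matched S1}" .
    qed
    then show "tower {} {S \<in> lowered M. \<Union>S = \<Union>S0}" using fib by simp
  qed
qed

lemma clique_iff_no_antipodes:
  assumes W: "card W = 4" and S: "S \<subseteq> Pow W"
  shows "clique S \<longleftrightarrow> (\<forall>A\<in>S. W - A \<notin> S)"
proof -
  have fW: "finite W" using W card_ge_0_finite by force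
  have "card (sdiff A B) \<le> 3 \<longleftrightarrow> B \<noteq> W - A" if "A \<subseteq> W" "B \<subseteq> W" for A B
  proof
    assume "card (sdiff A B) \<le> 3"
    then have "sdiff A B \<noteq> W" using W by auto
    then show "B \<noteq> W - A" using that by (auto simp: sdiff_def)
  next
    assume "B \<noteq> W - A"
    then have "sdiff A B \<subset> W" using that by (auto simp: sdiff_def)
    then have "card (sdiff A B) < card W" using fW by (rule psubset_card_mono[rotated])
    then show "card (sdiff A B) \<le> 3" using W by simp
  qed
  then show ?thesis using S unfolding clique_def by (metis PowD subset_iff)
qed

lemma mirror_vary:
  assumes "A \<in> S"
  shows "\<Union>(insert (A - {k}) S) = \<Union>S" "vary (insert (A - {k}) S) - {k} = vary S - {k}"
  using assms by (auto simp: vary_def)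

lemma finite_Pow_filter: "finite W \<Longrightarrow> finite {S. S \<subseteq> Pow W \<and> P S}"
  by (rule finite_subset[of _ "Pow (Pow W)"]) auto

lemma tower_small_face:
  assumes W: "finite W" "card W \<le> 3" and k: "k \<in> W"
  shows "tower {} {S. S \<subseteq> Pow W \<and> clique S \<and> \<Union>S = W \<and> vary S - {k} = W - {k}}" (is "tower {} ?F")
proof -
  have cl: "clique S" if "S \<subseteq> Pow W" for S
    unfolding clique_def
  proof (intro ballI)
    fix A B assume "A \<in> S" "B \<in> S"
    then have "sdiff A B \<subseteq> W" using that by (auto simp: sdiff_def)
    then show "card (sdiff A B) \<le> 3" using W card_mono by (meson le_trans)
  qed
  define top where "top S = {A\<in>S. k \<in> A}" for S
  show ?thesis
  proof (rule tower_fibres_empty[where \<phi> = top])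
    show "finite ?F" using W(1) by (rule finite_Pow_filter)
    show "top S \<subseteq> top T" if "S \<subseteq> T" for S T using that by (auto simp: top_def)
    fix S0 assume S0: "S0 \<in> ?F"
    then obtain A where A: "A \<in> S0" "k \<in> A" using k by blast
    let ?u = "A - {k}"
    have AW: "A \<subseteq> W" using A S0 by blast
    have mem: "A \<in> S" if "top S = top S0" for S using that A by (auto simp: top_def)
    show "tower {} {S \<in> ?F. top S = top S0}"
    proof (rule tower_toggle[of _ ?u])
      show "finite {S \<in> ?F. top S = top S0}" using W(1) finite_Pow_filter by simp
    next
      fix S assume "S \<in> {S \<in> ?F. top S = top S0}"
      then have S: "S \<subseteq> Pow W" "\<Union>S = W" "vary S - {k} = W - {k}" "top S = top S0" by auto
      have AS: "A \<in> S - {?u}" using mem[OF S(4)] A(2) by auto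
      have "top (insert ?u S) = top S0" "top (S - {?u}) = top S0" using S(4) by (auto simp: top_def)
      moreover have "insert ?u S \<subseteq> Pow W" "S - {?u} \<subseteq> Pow W" using S(1) AW by auto
      moreover have "\<Union>(insert ?u S) = W" "vary (insert ?u S) - {k} = W - {k}"
        using mirror_vary[of A S k] AS S by auto
      moreover have "insert ?u (S - {?u}) = insert ?u S" by blast
      then have "\<Union>(S - {?u}) = \<Union>(insert ?u S)" "vary (S - {?u}) - {k} = vary (insert ?u S) - {k}"
        using mirror_vary[OF AS, of k] by auto
      ultimately show "insert ?u S \<in> {S \<in> ?F. top S = top S0}" "S - {?u} \<in> {S \<in> ?F. top S = top S0}"
        using cl by auto
    qed
  qed
qed

lemma tower_half_cross_polytope:
  assumes W: "card W = 4" and k: "k \<in> W"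
  shows "\<exists>C\<subseteq>{8}. tower C {S. S \<subseteq> Pow W \<and> clique S \<and> \<Union>S = W \<and> vary S - {k} = W - {k}}"
proof -
  have fW: "finite W" using W card_ge_0_finite by force
  let ?F = "{S. S \<subseteq> Pow W \<and> (\<forall>A\<in>S. W - A \<notin> S) \<and> \<Union>S = W \<and> vary S - {k} = W - {k}}"
  have F: "{S. S \<subseteq> Pow W \<and> clique S \<and> \<Union>S = W \<and> vary S - {k} = W - {k}} = ?F"
    using clique_iff_no_antipodes[OF W] by blast
  define top where "top S = {A\<in>S. k \<in> A}" for S
  define full where "full = {A. k \<in> A \<and> A \<subseteq> W}"
  define c where "c A = (if A = full then {8 :: nat} else {})" for A
  have fin: "finite ?F" using fW by (rule finite_Pow_filter)
  have cfull: "card full = 8"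
  proof -
    have "full = insert k ` Pow (W - {k})"
    proof
      show "full \<subseteq> insert k ` Pow (W - {k})"
      proof
        fix A assume "A \<in> full"
        then have "A = insert k (A - {k})" "A - {k} \<in> Pow (W - {k})" by (auto simp: full_def)
        then show "A \<in> insert k ` Pow (W - {k})" by (rule image_eqI)
      qed
    qed (use k in \<open>auto simp: full_def\<close>)
    moreover have "inj_on (insert k) (Pow (W - {k}))" by (rule inj_onI) blast
    ultimately have "card full = card (Pow (W - {k}))" by (simp add: card_image)
    also have "\<dots> = 8" using W k fW by (simp add: card_Pow)
    finally show ?thesis .
  qed
  have "tower (c t) {S \<in> ?F. top S = t}" if t: "t \<in> top ` ?F" for t
  proof -
    obtain S0 where S0: "S0 \<in> ?F" "t = top S0" using t by blast
    have SW: "S0 \<subseteq> Pow W" "\<forall>A\<in>S0. W - A \<notin> S0" "\<Union>S0 = W" using S0 by auto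
    have tk: "k \<in> A \<and> A \<in> S \<and> A \<subseteq> W" if "A \<in> t" "S \<in> {S \<in> ?F. top S = t}" for A S
      using that by (auto simp: top_def)
    have tS: "A \<in> t" if "A \<in> S" "k \<in> A" "S \<in> {S \<in> ?F. top S = t}" for A S
      using that by (auto simp: top_def)
    have S0f: "S0 \<in> {S \<in> ?F. top S = t}" using S0 by simp
    let ?op = "\<lambda>A. W - (A - {k})"
    \<comment> \<open>the antipode of the mirror image of A\<close>
    show ?thesis
    proof (cases "\<exists>A\<in>t. ?op A \<notin> t")
      case True
      then obtain A where A: "A \<in> t" "?op A \<notin> t" by blast
      let ?u = "A - {k}"
      have AW: "A \<subseteq> W" "k \<in> A" using tk[OF A(1) S0f] by auto
      have "tower {} {S \<in> ?F. top S = t}"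
      proof (rule tower_toggle[of _ ?u])
        show "finite {S \<in> ?F. top S = t}" by (rule finite_subset[OF _ fin]) blast
      next
        fix S assume S': "S \<in> {S \<in> ?F. top S = t}"
        then have S: "S \<subseteq> Pow W" "\<forall>A\<in>S. W - A \<notin> S" "\<Union>S = W" "vary S - {k} = W - {k}" "top S = t" by auto
        have AS: "A \<in> S - {?u}" using tk[OF A(1) S'] AW(2) by auto
        have "top (insert ?u S) = t" "top (S - {?u}) = t" using S(5) by (auto simp: top_def)
        moreover have "insert ?u S \<subseteq> Pow W" "S - {?u} \<subseteq> Pow W" using S(1) AW by auto
        moreover have "\<Union>(insert ?u S) = W" "vary (insert ?u S) - {k} = W - {k}"
          using mirror_vary[of A S k] AS S by auto
        moreover have "insert ?u (S - {?u}) = insert ?u S" by blast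
        then have "\<Union>(S - {?u}) = \<Union>(insert ?u S)" "vary (S - {?u}) - {k} = vary (insert ?u S) - {k}"
          using mirror_vary[OF AS, of k] by auto
        moreover have opS: "W - ?u \<notin> S" using tS[OF _ _ S', of "W - ?u"] A(2) k by blast
        have "\<forall>B\<in>insert ?u S. W - B \<notin> insert ?u S"
        proof
          fix B assume B: "B \<in> insert ?u S"
          have "W - B \<noteq> ?u" if "B \<in> S"
          proof
            assume "W - B = ?u"
            then have "B = W - ?u" using that S(1) by blast
            then show False using opS that by simp
          qed
          moreover have "W - ?u \<noteq> ?u" using k by blast
          ultimately show "W - B \<notin> insert ?u S" using B opS S(2) by auto
        qed
        ultimately show "insert ?u S \<in> {S \<in> ?F. top S = t}" "S - {?u} \<in> {S \<in> ?F. top S = t}"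
          using S(2) by auto
      qed
      moreover have "t \<noteq> full" using A AW k by (auto simp: full_def)
      ultimately show ?thesis by (simp add: c_def)
    next
      case False
      then have closed: "?op A \<in> t" if "A \<in> t" for A using that by blast
      obtain A where A: "A \<in> t" using tS[OF _ _ S0f] SW(3) k by blast
      have AW: "A \<subseteq> W" "k \<in> A" using tk[OF A S0f] by auto
      show ?thesis
      proof (cases "t = full")
        case True
        have all: "S = t" if S: "S \<in> {S \<in> ?F. top S = t}" for S
        proof
          show "t \<subseteq> S" using tk S by blast
          show "S \<subseteq> t"
          proof
            fix B assume B: "B \<in> S"
            show "B \<in> t"
            proof (rule ccontr)
              assume "B \<notin> t"
              then have "k \<notin> B" using tS[OF B _ S] by blast
              then have "W - B \<in> t" using True k by (auto simp: full_def)
              then show False using tk[OF _ S] S B by blast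
            qed
          qed
        qed
        have "t \<in> {S \<in> ?F. top S = t}" using S0f all[OF S0f] by simp
        then have "{S \<in> ?F. top S = t} = {t}" by (intro equalityI subsetI) (simp_all only: all singleton_iff)
        then show ?thesis using tower_single[of t] cfull True by (simp add: c_def)
      next
        case False
        have "t \<subseteq> full" using tk[OF _ S0f] by (auto simp: full_def)
        then obtain B where B: "B \<in> full" "B \<notin> t" using False by blast
        have BW: "B \<subseteq> W" "k \<in> B" using B by (auto simp: full_def)
        let ?u = "B - {k}"
        have opB: "W - ?u \<notin> t"
        proof
          assume "W - ?u \<in> t"
          then have "?op (W - ?u) \<in> t" by (rule closed)
          moreover have "?op (W - ?u) = B" using BW k by blast
          ultimately show False using B(2) by simp
        qed
        have good: "\<Union>S = W \<and> vary S - {k} = W - {k}" if "t \<subseteq> S" "S \<subseteq> Pow W" for S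
        proof -
          have "A \<in> S" "?op A \<in> S" using that(1) A closed by auto
          then have "W \<subseteq> \<Union>S" "\<Inter>S \<subseteq> {k}" using AW by blast+
          moreover have "\<Union>S \<subseteq> W" using that(2) by blast
          ultimately show ?thesis unfolding vary_def by blast
        qed
        have "tower {} {S \<in> ?F. top S = t}"
        proof (rule tower_toggle[of _ ?u])
          show "finite {S \<in> ?F. top S = t}" by (rule finite_subset[OF _ fin]) blast
        next
          fix S assume S': "S \<in> {S \<in> ?F. top S = t}"
          then have S: "S \<subseteq> Pow W" "\<forall>A\<in>S. W - A \<notin> S" "top S = t" by auto
          have top: "top (insert ?u S) = t" "top (S - {?u}) = t" using S(3) by (auto simp: top_def)
          moreover have "insert ?u S \<subseteq> Pow W" "S - {?u} \<subseteq> Pow W" using S(1) BW by auto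
          moreover have "t \<subseteq> insert ?u S" "t \<subseteq> S - {?u}"
            using top by (auto simp: top_def)
          moreover have opS: "W - ?u \<notin> S" using tS[OF _ _ S', of "W - ?u"] opB k by blast
          have "\<forall>D\<in>insert ?u S. W - D \<notin> insert ?u S"
          proof
            fix D assume D: "D \<in> insert ?u S"
            have "W - D \<noteq> ?u" if "D \<in> S"
            proof
              assume "W - D = ?u"
              then have "D = W - ?u" using that S(1) by blast
              then show False using opS that by simp
            qed
            moreover have "W - ?u \<noteq> ?u" using k by blast
            ultimately show "W - D \<notin> insert ?u S" using D opS S(2) by auto
          qed
          ultimately show "insert ?u S \<in> {S \<in> ?F. top S = t}" "S - {?u} \<in> {S \<in> ?F. top S = t}"
            using S(2) good[of "insert ?u S"] good[of "S - {?u}"] by simp_all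
        qed
        then show ?thesis using False by (simp add: c_def)
      qed
    qed
  qed
  then have "tower (\<Union>t\<in>top ` ?F. c t) ?F"
    by (intro tower_fibres[OF fin]) (auto simp: top_def)
  moreover have "(\<Union>t\<in>top ` ?F. c t) \<subseteq> {8}" by (auto simp: c_def split: if_splits)
  ultimately show ?thesis unfolding F by blast
qed

lemma no_antipodes_insert:
  assumes "S \<subseteq> Pow W" "\<forall>A\<in>S. W - A \<notin> S" "u \<subseteq> W" "W - u \<notin> S" "W \<noteq> {}"
  shows "\<forall>A\<in>insert u S. W - A \<notin> insert u S"
proof
  fix A assume A: "A \<in> insert u S"
  have "W - A \<noteq> u" if "A \<in> S"
  proof
    assume "W - A = u"
    then have "A = W - u" using that assms(1) by blast
    then show False using assms(4) that by simp
  qed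
  moreover have "W - u \<noteq> u" using assms(5) by blast
  ultimately show "W - A \<notin> insert u S" using A assms(2,4) by auto
qed

lemma tower_corner_cover:
  fixes W :: "'a set"
  assumes W: "card W = 4" and a: "a \<in> W"
  shows "tower {5} {S. S \<subseteq> Pow W \<and> {} \<in> S \<and> {A\<in>S. a \<in> A} = {{a}} \<and> W - {a} \<notin> S \<and> \<Union>S = W}"
    (is "tower {5} ?F")
proof -
  have fW: "finite W" using W card_ge_0_finite by force
  have fin: "finite ?F" using fW by (rule finite_Pow_filter)
  have "card (W - {a}) = 3" using W a fW by simp
  then obtain b c d where bcd: "W - {a} = {b, c, d}" "distinct [b, c, d]"
    by (auto simp: card_3_iff)
  then have Wabcd: "W = {a, b, c, d}" "distinct [a, b, c, d]" using a by auto
  define side where "side S = {A\<in>S. b \<in> A}" for S :: "'a set set"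
  define c5 where "c5 t = (if t = {{b}} then {5 :: nat} else {})" for t
  define core where "core = {{}, {a}, {b}, {c}, {d}}"
  have core: "core \<in> ?F" "side core = {{b}}" "card core = 5"
    using Wabcd by (auto simp: core_def side_def)
  have five: "(\<Union>x\<in>B. if x then {} else {5}) = {5 :: nat}" if "False \<in> B" for B
    using that by (auto split: if_splits)
  have five': "(\<Union>t\<in>B. c5 t) = {5}" if "{{b}} \<in> B" for B
    using that by (auto simp: c5_def split: if_splits)
  have fibres: "tower (c5 t) {S \<in> ?F. side S = t}" if t: "t \<in> side ` ?F" for t
  proof -
    obtain S0 where S0: "S0 \<in> ?F" "side S0 = t" using t by blast
    show ?thesis
    proof (cases "t = {{b}}")
      case False
      have "\<Union>S0 = W" using S0(1) by blast
      then have "b \<in> \<Union>S0" using Wabcd(1) by simp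
      then obtain A0 where "A0 \<in> S0" "b \<in> A0" by blast
      then have "A0 \<in> t" using S0(2) by (auto simp: side_def)
      then obtain A where A: "A \<in> t" "A \<noteq> {b}" using False by blast
      let ?u = "A - {b}"
      have "b \<in> A" "A \<in> S0" using A(1) S0(2) by (auto simp: side_def)
      moreover have "a \<notin> A"
      proof
        assume "a \<in> A"
        then have "A \<in> {{a}}" using \<open>A \<in> S0\<close> S0(1) by blast
        then show False using \<open>b \<in> A\<close> Wabcd(2) by auto
      qed
      moreover have "S0 \<subseteq> Pow W" using S0(1) by blast
      ultimately have AW: "A \<subseteq> W" "b \<in> A" "a \<notin> A" by auto
      have u: "?u \<noteq> {}" "?u \<subseteq> W" "a \<notin> ?u" "?u \<noteq> W - {a}"
        using A(2) AW bcd by auto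
      have "tower {} {S \<in> ?F. side S = t}"
      proof (rule tower_toggle[of _ ?u])
        show "finite {S \<in> ?F. side S = t}" by (rule finite_subset[OF _ fin]) blast
      next
        fix S assume "S \<in> {S \<in> ?F. side S = t}"
        then have S: "S \<subseteq> Pow W" "{} \<in> S" "{A\<in>S. a \<in> A} = {{a}}" "W - {a} \<notin> S" "\<Union>S = W" "side S = t"
          by auto
        have AS: "A \<in> S" using A(1) S(6) by (auto simp: side_def)
        have "\<Union>(insert ?u S) = W" using S(5) AW(1) by auto
        moreover have "\<Union>(S - {?u}) = W"
        proof -
          have "A \<in> S - {?u}" using AS AW(2) by auto
          then have "\<Union>(S - {?u}) = \<Union>(insert ?u S)" by auto
          then show ?thesis using \<open>\<Union>(insert ?u S) = W\<close> by simp
        qed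
        moreover have "side (insert ?u S) = t" "side (S - {?u}) = t" using S(6) by (auto simp: side_def)
        moreover have "{A\<in>insert ?u S. a \<in> A} = {{a}}" "{A\<in>S - {?u}. a \<in> A} = {{a}}"
        proof -
          have "{A\<in>insert ?u S. a \<in> A} = {A\<in>S. a \<in> A}" "{A\<in>S - {?u}. a \<in> A} = {A\<in>S. a \<in> A}"
            using u(3) by auto
          then show "{A\<in>insert ?u S. a \<in> A} = {{a}}" "{A\<in>S - {?u}. a \<in> A} = {{a}}" using S(3) by simp_all
        qed
        moreover have "insert ?u S \<subseteq> Pow W" "S - {?u} \<subseteq> Pow W" using S(1) u(2) by blast+
        moreover have "{} \<in> insert ?u S" "{} \<in> S - {?u}" "W - {a} \<notin> insert ?u S" "W - {a} \<notin> S - {?u}"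
          using S(2,4) u(1,4) by auto
        ultimately show "insert ?u S \<in> {S \<in> ?F. side S = t}" "S - {?u} \<in> {S \<in> ?F. side S = t}"
          by (simp_all only: mem_Collect_eq simp_thms)
      qed
      then show ?thesis using False by (simp add: c5_def)
    next
      case True
      let ?G = "{S \<in> ?F. side S = t}"
      have fG: "finite ?G" by (rule finite_subset[OF _ fin]) blast
      have "tower (if x then {} else {5}) {S \<in> ?G. ({c, d} \<in> S) = x}" for x
      proof (cases x)
        case True
        have "tower {} {S \<in> ?G. ({c, d} \<in> S) = x}"
        proof (rule tower_toggle[of _ "{c}"])
          show "finite {S \<in> ?G. ({c, d} \<in> S) = x}" by (rule finite_subset[OF _ fG]) blast
        next
          fix S assume "S \<in> {S \<in> ?G. ({c, d} \<in> S) = x}"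
          then have S: "S \<subseteq> Pow W" "{} \<in> S" "{A\<in>S. a \<in> A} = {{a}}" "W - {a} \<notin> S" "\<Union>S = W" "side S = t"
            "{c, d} \<in> S" using True by auto
          have ne: "{c, d} \<noteq> {c}" "{c} \<noteq> W - {a}" "a \<notin> {c}" "{c} \<subseteq> W" "b \<notin> {c}" using Wabcd by auto
          have "\<Union>(insert {c} S) = W" using S(5) ne by auto
          moreover have "\<Union>(S - {{c}}) = W"
          proof -
            have "{c, d} \<in> S - {{c}}" using S(7) ne by auto
            then have "\<Union>(S - {{c}}) = \<Union>(insert {c} S)" by auto
            then show ?thesis using \<open>\<Union>(insert {c} S) = W\<close> by simp
          qed
          moreover have "side (insert {c} S) = t" "side (S - {{c}}) = t"
            using S(6) ne(5) by (auto simp: side_def)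
          moreover have "{A\<in>insert {c} S. a \<in> A} = {{a}}" "{A\<in>S - {{c}}. a \<in> A} = {{a}}"
          proof -
            have "{A\<in>insert {c} S. a \<in> A} = {A\<in>S. a \<in> A}" "{A\<in>S - {{c}}. a \<in> A} = {A\<in>S. a \<in> A}"
              using ne(3) by auto
            then show "{A\<in>insert {c} S. a \<in> A} = {{a}}" "{A\<in>S - {{c}}. a \<in> A} = {{a}}" using S(3) by simp_all
          qed
          moreover have "insert {c} S \<subseteq> Pow W" "S - {{c}} \<subseteq> Pow W" using S(1) ne(4) by blast+
          moreover have "{} \<in> insert {c} S" "{} \<in> S - {{c}}" "W - {a} \<notin> insert {c} S" "W - {a} \<notin> S - {{c}}"
            "({c, d} \<in> insert {c} S) = x" "({c, d} \<in> S - {{c}}) = x"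
            using S(2,4,7) ne(1,2) True by auto
          ultimately show "insert {c} S \<in> {S \<in> ?G. ({c, d} \<in> S) = x}" "S - {{c}} \<in> {S \<in> ?G. ({c, d} \<in> S) = x}"
            by (simp_all only: mem_Collect_eq simp_thms)
        qed
        then show ?thesis using True by simp
      next
        case False
        have all: "S = core" if S: "S \<in> {S \<in> ?G. ({c, d} \<in> S) = x}" for S
        proof -
          have S: "S \<subseteq> Pow W" "{} \<in> S" "{A\<in>S. a \<in> A} = {{a}}" "\<Union>S = W" "{A\<in>S. b \<in> A} = {{b}}" "{c, d} \<notin> S"
            using S False \<open>t = {{b}}\<close> by (auto simp: side_def)
          have sub: "A \<in> core" if A: "A \<in> S" for A
          proof (cases "a \<in> A \<or> b \<in> A")
            case True
            then have "A \<in> {{a}} \<or> A \<in> {{b}}" using A S(3,5) by blast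
            then show ?thesis by (auto simp: core_def)
          next
            case False
            then have "A \<subseteq> {c, d}" using A S(1) Wabcd(1) by auto
            then have "A \<in> Pow {c, d}" by simp
            then have "A \<in> {{}, {c}, {d}, {c, d}}" by (simp add: Pow_insert) blast
            then show ?thesis using A S(6) by (auto simp: core_def)
          qed
          have "{i} \<in> S" if i: "i \<in> W" for i
          proof -
            obtain A where A: "A \<in> S" "i \<in> A" using i S(4) by blast
            then have "A = {i}" using sub[OF A(1)] by (auto simp: core_def)
            then show ?thesis using A by simp
          qed
          then have "core \<subseteq> S" using S(2) Wabcd(1) by (simp add: core_def)
          then show ?thesis using sub by blast
        qed
        have mem: "core \<in> {S \<in> ?G. ({c, d} \<in> S) = x}"
          using core(1,2) \<open>t = {{b}}\<close> False Wabcd(2) by (auto simp: core_def doubleton_eq_iff)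
        have "{S \<in> ?G. ({c, d} \<in> S) = x} = {core}"
        proof (rule antisym)
          show "{S \<in> ?G. ({c, d} \<in> S) = x} \<subseteq> {core}" by (rule subsetI, drule all, erule ssubst, rule singletonI)
          show "{core} \<subseteq> {S \<in> ?G. ({c, d} \<in> S) = x}" using mem by (rule insert_subsetI) (rule empty_subsetI)
        qed
        then show ?thesis using tower_single[of core] core(3) False by simp
      qed
      then have "tower (\<Union>x\<in>(\<lambda>S. {c, d} \<in> S) ` ?G. if x then {} else {5}) ?G"
        by (intro tower_fibres[OF fG]) auto
      moreover have "False \<in> (\<lambda>S. {c, d} \<in> S) ` ?G"
      proof (rule image_eqI)
        show "core \<in> ?G" using core True by simp
        show "False = ({c, d} \<in> core)" using Wabcd(2) by (auto simp: core_def doubleton_eq_iff)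
      qed
      then have "(\<Union>x\<in>(\<lambda>S. {c, d} \<in> S) ` ?G. if x then {} else {5}) = {5 :: nat}"
        by (rule five)
      ultimately have "tower {5} ?G" by (simp only:)
      then show ?thesis using True by (simp only: c5_def if_True refl)
    qed
  qed
  have "tower (\<Union>t\<in>side ` ?F. c5 t) ?F"
    by (rule tower_fibres[OF fin _ fibres]) (auto simp: side_def)
  moreover have "{{b}} \<in> side ` ?F"
  proof (rule image_eqI[where x = core])
    show "{{b}} = side core" using core(2) by simp
  qed (rule core(1))
  then have "(\<Union>t\<in>side ` ?F. c5 t) = {5}" by (rule five')
  ultimately show ?thesis by (simp only:)
qed

lemma tower_corner:
  fixes W :: "'a set"
  assumes W: "card W = 4"
  shows "tower {5, 8} {S. S \<subseteq> Pow W \<and> {} \<in> S \<and> (\<forall>A\<in>S. W - A \<notin> S) \<and> \<Union>S = W}" (is "tower _ ?F")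
proof -
  have fW: "finite W" using W card_ge_0_finite by force
  have fin: "finite ?F" using fW by (rule finite_Pow_filter)
  obtain a where a: "a \<in> W" using W by fastforce
  define top where "top S = {A\<in>S. a \<in> A}" for S
  define full where "full = {A. a \<in> A \<and> A \<subseteq> W \<and> A \<noteq> W}"
  define cs where "cs t = (if t = {{a}} then {5 :: nat} else if t = full then {8} else {})" for t
  have full_card: "card full = 7"
  proof -
    have "insert W full = insert a ` Pow (W - {a})"
    proof
      show "insert W full \<subseteq> insert a ` Pow (W - {a})"
      proof
        fix A assume "A \<in> insert W full"
        then have "A = insert a (A - {a})" "A - {a} \<in> Pow (W - {a})" using a by (auto simp: full_def)
        then show "A \<in> insert a ` Pow (W - {a})" by (rule image_eqI)
      qed
    qed (use a in \<open>auto simp: full_def\<close>)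
    moreover have "inj_on (insert a) (Pow (W - {a}))" by (rule inj_onI) blast
    then have "card (insert a ` Pow (W - {a})) = 8" using W a fW by (simp add: card_image card_Pow)
    moreover have "W \<notin> full" "finite full" using fW by (auto simp: full_def)
    ultimately have "Suc (card full) = 8" by (metis card_insert_disjoint)
    then show ?thesis by simp
  qed
  have Wne: "W \<noteq> {}" "W \<noteq> {a}" using W by auto
  have memb: "{} \<in> S" "S \<subseteq> Pow W" "\<forall>A\<in>S. W - A \<notin> S" "\<Union>S = W" "W \<notin> S" if "S \<in> ?F" for S
    using that by auto
  \<comment> \<open>toggling below level a, where only the antipode can obstruct\<close>
  have toggle: "tower {} {S \<in> ?F. top S = t}"
    if u: "u \<subseteq> W" "a \<notin> u" "u \<noteq> {}" "W - u \<notin> t"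
      and cover: "\<And>S. S \<in> ?F \<Longrightarrow> top S = t \<Longrightarrow> \<Union>(S - {u}) = W" for u t
  proof (rule tower_toggle[of _ u])
    show "finite {S \<in> ?F. top S = t}" by (rule finite_subset[OF _ fin]) blast
  next
    fix S assume S': "S \<in> {S \<in> ?F. top S = t}"
    then have S: "S \<in> ?F" "top S = t" by blast+
    note m = memb[OF S(1)]
    have "W - u \<notin> S" using S(2) u(2,4) a by (auto simp: top_def)
    then have "\<forall>A\<in>insert u S. W - A \<notin> insert u S"
      using no_antipodes_insert[OF m(2,3) u(1)] Wne(1) by blast
    moreover have "\<forall>A\<in>S - {u}. W - A \<notin> S - {u}" using m(3) by blast
    moreover have "top (insert u S) = t" "top (S - {u}) = t" using S(2) u(2) by (auto simp: top_def)
    moreover have "insert u S \<subseteq> Pow W" "S - {u} \<subseteq> Pow W" using m(2) u(1) by blast+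
    moreover have "\<Union>(insert u S) = W" using m(4) u(1) by auto
    moreover have "\<Union>(S - {u}) = W" using cover S .
    moreover have "{} \<in> insert u S" "{} \<in> S - {u}" using m(1) u(3) by auto
    ultimately show "insert u S \<in> {S \<in> ?F. top S = t}" "S - {u} \<in> {S \<in> ?F. top S = t}"
      by (simp_all only: mem_Collect_eq simp_thms)
  qed
  have fibres: "tower (cs t) {S \<in> ?F. top S = t}" if t: "t \<in> top ` ?F" for t
  proof -
    obtain S0 where S0: "S0 \<in> ?F" "t = top S0" using t by blast
    note m0 = memb[OF S0(1)]
    have tW: "A \<subseteq> W" "a \<in> A" "A \<noteq> W" if "A \<in> t" for A
      using that S0(2) m0(2,5) by (auto simp: top_def)
    obtain A0 where A0: "A0 \<in> t" using m0(4) a S0(2) unfolding top_def by blast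
    have tS: "t \<subseteq> S" if "top S = t" for S using that by (auto simp: top_def)
    let ?op = "\<lambda>A. W - (A - {a})"
    show ?thesis
    proof (cases "\<exists>A\<in>t. A \<noteq> {a} \<and> ?op A \<notin> t")
      case True
      then obtain A where A: "A \<in> t" "A \<noteq> {a}" "?op A \<notin> t" by blast
      have "\<Union>(S - {A - {a}}) = W" if "S \<in> ?F" "top S = t" for S
      proof -
        have "A \<in> S - {A - {a}}" using tS[OF that(2)] A(1) tW(2)[OF A(1)] by auto
        then have "\<Union>(S - {A - {a}}) = \<Union>S" by auto
        then show ?thesis using memb(4)[OF that(1)] by simp
      qed
      then have "tower {} {S \<in> ?F. top S = t}"
        using A tW[OF A(1)] by (intro toggle[of "A - {a}"]) auto
      moreover have "t \<noteq> {{a}}" using A by auto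
      moreover have "t \<noteq> full"
      proof
        assume "t = full"
        moreover have "?op A \<in> full" using A(2) tW[OF A(1)] a by (auto simp: full_def)
        ultimately show False using A(3) by simp
      qed
      ultimately show ?thesis by (simp only: cs_def if_False)
    next
      case False
      then have closed: "?op A \<in> t" if "A \<in> t" "A \<noteq> {a}" for A using that by blast
      show ?thesis
      proof (cases "t = {{a}}")
        case True
        have "{S \<in> ?F. top S = t}
            = {S. S \<subseteq> Pow W \<and> {} \<in> S \<and> {A\<in>S. a \<in> A} = {{a}} \<and> W - {a} \<notin> S \<and> \<Union>S = W}"
        proof (intro equalityI subsetI)
          fix S assume "S \<in> {S \<in> ?F. top S = t}"
          then have S: "S \<in> ?F" "top S = t" by blast+
          note m = memb[OF S(1)]
          have "{a} \<in> S" using tS[OF S(2)] True by simp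
          then have "W - {a} \<notin> S" using m(3) by blast
          then show "S \<in> {S. S \<subseteq> Pow W \<and> {} \<in> S \<and> {A\<in>S. a \<in> A} = {{a}} \<and> W - {a} \<notin> S \<and> \<Union>S = W}"
            using m S(2) True by (simp add: top_def)
        next
          fix S assume "S \<in> {S. S \<subseteq> Pow W \<and> {} \<in> S \<and> {A\<in>S. a \<in> A} = {{a}} \<and> W - {a} \<notin> S \<and> \<Union>S = W}"
          then have S: "S \<subseteq> Pow W" "{} \<in> S" "{A\<in>S. a \<in> A} = {{a}}" "W - {a} \<notin> S" "\<Union>S = W" by blast+
          have only: "A = {a}" if "A \<in> S" "a \<in> A" for A using S(3) that by blast
          have "W - A \<notin> S" if A: "A \<in> S" for A
          proof
            assume WA: "W - A \<in> S"
            show False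
            proof (cases "a \<in> A")
              case True then show False using only[OF A] WA S(4) by simp
            next
              case False
              then have "W - A = {a}" using only[OF WA] a by blast
              then have "A = W - {a}" using S(1) A by blast
              then show False using S(4) A by simp
            qed
          qed
          then show "S \<in> {S \<in> ?F. top S = t}" using S True by (simp add: top_def)
        qed
        then show ?thesis using tower_corner_cover[OF W a] True by (simp add: cs_def)
      next
        case False
        obtain A where A: "A \<in> t" "A \<noteq> {a}" using A0 False by blast
        have AW: "A \<union> ?op A = W" "A \<in> t" "?op A \<in> t" using A tW[OF A(1)] closed by auto
        have cover: "\<Union>(S - {u}) = W" if "a \<notin> u" "S \<in> ?F" "top S = t" for S u
        proof -
          have "A \<in> S - {u}" "?op A \<in> S - {u}" using tS[OF that(3)] AW(2,3) tW(2) that(1) by blast+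
          then have "W \<subseteq> \<Union>(S - {u})" using AW(1) by blast
          then show ?thesis using memb(4)[OF that(2)] by blast
        qed
        show ?thesis
        proof (cases "\<exists>B\<in>full. B \<noteq> {a} \<and> B \<notin> t")
          case True
          then obtain B where B: "B \<in> full" "B \<noteq> {a}" "B \<notin> t" by blast
          have BW: "B \<subseteq> W" "a \<in> B" "B \<noteq> W" using B(1) by (auto simp: full_def)
          have "W - (B - {a}) \<notin> t"
          proof
            assume "W - (B - {a}) \<in> t"
            moreover obtain x where "x \<in> W" "x \<notin> B" using BW(1,3) by blast
            then have "W - (B - {a}) \<noteq> {a}" using BW(2) by auto
            ultimately have "?op (W - (B - {a})) \<in> t" by (rule closed)
            moreover have "?op (W - (B - {a})) = B" using BW a by blast
            ultimately show False using B(3) by simp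
          qed
          then have "tower {} {S \<in> ?F. top S = t}"
            using B(2) BW cover by (intro toggle[of "B - {a}"]) auto
          moreover have "t \<noteq> full" using B by blast
          ultimately show ?thesis using False by (simp only: cs_def if_False)
        next
          case big: False
          show ?thesis
          proof (cases "{a} \<in> t")
            case False': False
            have "tower {} {S \<in> ?F. top S = t}"
            proof (rule toggle[of "W - {a}"])
              have "W - (W - {a}) = {a}" using a by blast
              then show "W - (W - {a}) \<notin> t" using False' by simp
            qed (use Wne a cover in auto)
            moreover have "{a} \<in> full" using a Wne by (auto simp: full_def)
            then have "t \<noteq> full" using False' by blast
            ultimately show ?thesis using False by (simp only: cs_def if_False)
          next
            case True
            have tf: "t = full"
            proof
              show "t \<subseteq> full" using tW by (auto simp: full_def)
              show "full \<subseteq> t"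
              proof
                fix B assume "B \<in> full"
                then show "B \<in> t" using big True by (cases "B = {a}") auto
              qed
            qed
            have all: "S = insert {} full" if S: "S \<in> ?F" "top S = t" for S
            proof
              show "insert {} full \<subseteq> S" using tS[OF S(2)] memb(1)[OF S(1)] tf by simp
              show "S \<subseteq> insert {} full"
              proof
                fix B assume B: "B \<in> S"
                note m = memb[OF S(1)]
                show "B \<in> insert {} full"
                proof (rule ccontr)
                  assume nB: "B \<notin> insert {} full"
                  have "a \<notin> B" using nB B m(2,5) by (auto simp: full_def)
                  then have "W - B \<in> full" using a nB B m(2) by (auto simp: full_def)
                  then have "W - B \<in> S" using tS[OF S(2)] tf by blast
                  then show False using m(3) B by blast
                qed
              qed
            qed
            have "S0 = insert {} full" using all S0 by simp
            then have mem: "insert {} full \<in> {S \<in> ?F. top S = t}" using S0 by blast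
            have "{S \<in> ?F. top S = t} = {insert {} full}"
            proof (rule antisym)
              show "{S \<in> ?F. top S = t} \<subseteq> {insert {} full}"
              proof
                fix S assume "S \<in> {S \<in> ?F. top S = t}"
                then have "S \<in> ?F" "top S = t" by blast+
                then have "S = insert {} full" by (rule all)
                then show "S \<in> {insert {} full}" by (rule ssubst) (rule singletonI)
              qed
              show "{insert {} full} \<subseteq> {S \<in> ?F. top S = t}" using mem by (rule insert_subsetI) (rule empty_subsetI)
            qed
            moreover have "card (insert {} full) = 8"
              using full_card card_ge_0_finite[of full] by (subst card_insert_disjoint) (auto simp: full_def)
            ultimately have "tower {8} {S \<in> ?F. top S = t}" using tower_single[of "insert {} full"] by (simp only:)
            then show ?thesis using False tf by (simp only: cs_def if_False if_True refl)
          qed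
        qed
      qed
    qed
  qed
  have union: "(\<Union>t\<in>B. cs t) = {5, 8}" if "{{a}} \<in> B" "full \<in> B" for B
  proof -
    have "full \<noteq> {{a}}" using full_card by auto
    then show ?thesis using that by (auto simp: cs_def split: if_splits)
  qed
  have "tower (\<Union>t\<in>top ` ?F. cs t) ?F"
    by (rule tower_fibres[OF fin _ fibres]) (auto simp: top_def)
  moreover have "{{a}} \<in> top ` ?F"
  proof (rule image_eqI)
    let ?S = "insert {} ((\<lambda>i. {i}) ` W)"
    show "{{a}} = top ?S" using a by (auto simp: top_def)
    have "W - {i} \<noteq> {j}" "W - {i} \<noteq> {}" "W \<noteq> {i}" if "i \<in> W" for i j
    proof -
      have "card (W - {i}) = 3" using W fW that by simp
      then show "W - {i} \<noteq> {j}" "W - {i} \<noteq> {}" by (metis One_nat_def card.empty card_1_singleton_iff numeral_eq_one_iff semiring_norm(86) zero_neq_numeral)+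
      show "W \<noteq> {i}" using W by auto
    qed
    then have "\<forall>A\<in>?S. W - A \<notin> ?S" using Wne(1) by auto
    then show "?S \<in> ?F" by auto
  qed
  moreover have "full \<in> top ` ?F"
  proof (rule image_eqI)
    show "full = top (insert {} full)" by (auto simp: top_def full_def)
    have "\<Union>(insert {} full) = W"
    proof
      show "W \<subseteq> \<Union>(insert {} full)"
      proof
        fix x assume x: "x \<in> W"
        have "card {a, x} \<le> 2" by (simp add: card_insert_if)
        then have "{a, x} \<noteq> W" using W by auto
        then have "{a, x} \<in> full" using a x by (auto simp: full_def)
        then show "x \<in> \<Union>(insert {} full)" by blast
      qed
    qed (auto simp: full_def)
    moreover have "\<forall>A\<in>insert {} full. W - A \<notin> insert {} full" using Wne(1) by (auto simp: full_def)
    moreover have "insert {} full \<subseteq> Pow W" by (auto simp: full_def)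
    ultimately show "insert {} full \<in> ?F" by blast
  qed
  ultimately show ?thesis using union by (simp only:)
qed

lemma tower_cross_polytope:
  fixes W :: "'a set"
  assumes W: "card W = 4"
  shows "tower {5, 8} {S. S \<subseteq> Pow W \<and> clique S \<and> vary S = W}"
proof -
  have fW: "finite W" using W card_ge_0_finite by force
  have Wne: "W \<noteq> {}" using W by auto
  let ?F = "{S. S \<subseteq> Pow W \<and> (\<forall>A\<in>S. W - A \<notin> S) \<and> vary S = W}"
  have F: "{S. S \<subseteq> Pow W \<and> clique S \<and> vary S = W} = ?F"
    using clique_iff_no_antipodes[OF W] by blast
  have fin: "finite ?F" using fW by (rule finite_Pow_filter)
  define r :: "'a set set \<Rightarrow> nat" where
    "r S = (if {} \<in> S then 2 else if W \<in> S \<and> vary (S - {W}) \<noteq> W then 0 else 1)" for S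
  have varyW: "vary S = W \<longleftrightarrow> \<Union>S = W \<and> \<Inter>S \<inter> W = {}" if "S \<subseteq> Pow W" for S
    using that by (auto simp: vary_def)
  have mono: "r S \<le> r T" if S: "S \<in> ?F" "T \<in> ?F" "S \<subseteq> T" for S T
  proof (cases "{} \<notin> T \<and> W \<in> T \<and> vary (T - {W}) \<noteq> W")
    case True
    have TW: "vary (T - {W}) \<subset> W" using True S(2) by (auto simp: vary_def)
    show ?thesis
    proof (cases "W \<in> S")
      case True
      have "vary (S - {W}) \<subseteq> vary (T - {W})" using S(3) by (intro vary_mono) blast
      then have "vary (S - {W}) \<noteq> W" using TW by blast
      then show ?thesis using True S(3) \<open>{} \<notin> T \<and> _\<close> by (auto simp: r_def)
    next
      case False
      then have "vary S \<subseteq> vary (T - {W})" using S(3) by (intro vary_mono) blast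
      then show ?thesis using TW S(1) by blast
    qed
  next
    case False
    then show ?thesis using S(3) by (auto simp: r_def)
  qed
  have f2: "tower {5, 8} {S \<in> ?F. r S = 2}"
  proof -
    have "{S \<in> ?F. r S = 2} = {S. S \<subseteq> Pow W \<and> {} \<in> S \<and> (\<forall>A\<in>S. W - A \<notin> S) \<and> \<Union>S = W}"
    proof -
      have "r S = 2 \<longleftrightarrow> {} \<in> S" for S by (simp add: r_def)
      moreover have "vary S = W \<longleftrightarrow> \<Union>S = W" if "{} \<in> S" for S using that by (auto simp: vary_def)
      ultimately show ?thesis by blast
    qed
    then show ?thesis using tower_corner[OF W] by (simp only:)
  qed
  have f1: "tower {} {S \<in> ?F. r S = 1}"
  proof (rule tower_toggle[of _ W])
    show "finite {S \<in> ?F. r S = 1}" by (rule finite_subset[OF _ fin]) blast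
  next
    fix S assume "S \<in> {S \<in> ?F. r S = 1}"
    then have S: "S \<subseteq> Pow W" "\<forall>A\<in>S. W - A \<notin> S" "vary S = W" "{} \<notin> S" "W \<in> S \<Longrightarrow> vary (S - {W}) = W"
      by (auto simp: r_def split: if_splits)
    have v: "vary (S - {W}) = W" using S(3,5) by (cases "W \<in> S") simp_all
    have "vary (S - {W}) \<subseteq> vary (insert W S)" by (rule vary_mono) blast
    moreover have "insert W S \<subseteq> Pow W" using S(1) by blast
    then have "vary (insert W S) \<subseteq> W" by (auto simp: vary_def)
    ultimately have iv: "vary (insert W S) = W" using v by simp
    have "insert W S - {W} = S - {W}" by blast
    then have "r (insert W S) = 1" "r (S - {W}) = 1" using S(4) v Wne by (simp_all add: r_def)
    moreover have "W - W \<notin> S" using S(4) by simp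
    then have "\<forall>A\<in>insert W S. W - A \<notin> insert W S"
      using no_antipodes_insert[OF S(1,2) subset_refl] Wne by blast
    moreover have "\<forall>A\<in>S - {W}. W - A \<notin> S - {W}" using S(2) by blast
    moreover have "S - {W} \<subseteq> Pow W" using S(1) by blast
    ultimately show "insert W S \<in> {S \<in> ?F. r S = 1}" "S - {W} \<in> {S \<in> ?F. r S = 1}"
      using iv v \<open>insert W S \<subseteq> Pow W\<close> by (simp_all only: mem_Collect_eq simp_thms)
  qed
  have f0: "tower {} {S \<in> ?F. r S = 0}"
  proof -
    have "{S \<in> ?F. r S = 0} = {S. W \<in> S \<and> {} \<notin> S \<and> \<Inter>S = {} \<and> \<Union>S = W \<and> \<Union>(S - {W}) \<noteq> W}"
    proof (intro equalityI subsetI)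
      fix S assume "S \<in> {S \<in> ?F. r S = 0}"
      then have S: "S \<subseteq> Pow W" "vary S = W" "{} \<notin> S" "W \<in> S" "vary (S - {W}) \<noteq> W"
        by (auto simp: r_def split: if_splits)
      have "\<Union>S = W" "\<Inter>S = {}" using S(2,4) varyW[OF S(1)] by auto
      moreover have "\<Union>(S - {W}) \<noteq> W"
      proof
        assume U: "\<Union>(S - {W}) = W"
        have "\<Inter>(S - {W}) \<inter> W \<subseteq> \<Inter>S" by blast
        then have "\<Inter>(S - {W}) \<inter> W = {}" using \<open>\<Inter>S = {}\<close> by simp
        moreover have "S - {W} \<subseteq> Pow W" using S(1) by blast
        ultimately show False using U S(5) varyW[of "S - {W}"] by simp
      qed
      ultimately show "S \<in> {S. W \<in> S \<and> {} \<notin> S \<and> \<Inter>S = {} \<and> \<Union>S = W \<and> \<Union>(S - {W}) \<noteq> W}"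
        using S by simp
    next
      fix S assume "S \<in> {S. W \<in> S \<and> {} \<notin> S \<and> \<Inter>S = {} \<and> \<Union>S = W \<and> \<Union>(S - {W}) \<noteq> W}"
      then have S: "W \<in> S" "{} \<notin> S" "\<Inter>S = {}" "\<Union>S = W" "\<Union>(S - {W}) \<noteq> W" by auto
      have SW: "S \<subseteq> Pow W" using S(4) by blast
      have "W - A \<notin> S" if A: "A \<in> S" for A
      proof
        assume WA: "W - A \<in> S"
        have "A \<noteq> W" "A \<noteq> {}" using WA S(2) A by auto
        moreover have "W - A \<noteq> W" using A \<open>A \<noteq> {}\<close> SW by blast
        ultimately have "A \<in> S - {W}" "W - A \<in> S - {W}" using A WA by blast+
        then have "W \<subseteq> \<Union>(S - {W})" by blast
        then show False using S(5) SW by blast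
      qed
      moreover have "vary S = W" using varyW[OF SW] S by simp
      moreover have "vary (S - {W}) \<noteq> W"
      proof -
        have "S - {W} \<subseteq> Pow W" using SW by blast
        then show ?thesis using varyW[of "S - {W}"] S(5) by simp
      qed
      ultimately show "S \<in> {S \<in> ?F. r S = 0}" using SW S by (simp add: r_def)
    qed
    then show ?thesis using tower_insert_lowered[OF tower_lowered[OF fW]] by (simp only:)
  qed
  have fib: "tower (if b = 2 then {5, 8} else {}) {S \<in> ?F. r S = b}" for b
  proof -
    consider "b = 0" | "b = 1" | "b = 2" | "\<forall>S. r S \<noteq> b" unfolding r_def by metis
    then show ?thesis
    proof cases
      case 4
      then have "{S \<in> ?F. r S = b} = {}" by simp
      moreover have "r {{}} = 2" by (simp add: r_def)
      then have "b \<noteq> 2" using 4 by metis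
      ultimately show ?thesis using tower.empty by (simp only: if_False)
    qed (use f0 f1 f2 in simp_all)
  qed
  have union: "(\<Union>b\<in>B. if b = 2 then {5, 8} else {}) = {5, 8 :: nat}" if "(2::nat) \<in> B" for B
    using that by (auto split: if_splits)
  have "tower (\<Union>b\<in>r ` ?F. if b = 2 then {5, 8} else {}) ?F"
    by (rule tower_fibres[OF fin mono fib])
  moreover have "2 \<in> r ` ?F"
  proof (rule ccontr)
    assume "2 \<notin> r ` ?F"
    then have "{S \<in> ?F. r S = 2} = {}" by (metis (mono_tags, lifting) Collect_empty_eq imageI)
    then have "tower {5, 8} ({} :: 'a set set set)" using f2 by (simp only:)
    then show False by (cases rule: tower.cases) auto
  qed
  ultimately have "tower {5, 8} ?F" using union by (simp only:)
  then show ?thesis unfolding F .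
qed

lemma lift_family:
  assumes L: "L \<inter> W = {}"
  shows "{S. S \<noteq> {} \<and> S \<subseteq> Pow (L \<union> W) \<and> L \<subseteq> \<Inter>S \<and> clique S \<and> Q (\<Union>S) (vary S)}
    = (`) ((\<union>) L) ` {S. S \<noteq> {} \<and> S \<subseteq> Pow W \<and> clique S \<and> Q (L \<union> \<Union>S) (vary S)}"
proof -
  have lift: "\<Union>((\<union>) L ` S) = L \<union> \<Union>S" "vary ((\<union>) L ` S) = vary S" "clique ((\<union>) L ` S) = clique S"
    if S: "S \<noteq> {}" "S \<subseteq> Pow W" for S
  proof -
    show U: "\<Union>((\<union>) L ` S) = L \<union> \<Union>S" using S(1) by auto
    have I: "\<Inter>((\<union>) L ` S) = L \<union> \<Inter>S" by auto
    have "\<Union>S \<inter> L = {}" using S(2) L by blast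
    then show "vary ((\<union>) L ` S) = vary S" unfolding vary_def U I by blast
    have "sdiff (L \<union> A) (L \<union> B) = sdiff A B" if "A \<in> S" "B \<in> S" for A B
      using that S(2) L by (auto simp: sdiff_def)
    then show "clique ((\<union>) L ` S) = clique S" by (simp add: clique_def)
  qed
  show ?thesis
  proof (intro equalityI subsetI)
    fix S assume "S \<in> {S. S \<noteq> {} \<and> S \<subseteq> Pow (L \<union> W) \<and> L \<subseteq> \<Inter>S \<and> clique S \<and> Q (\<Union>S) (vary S)}"
    then have S: "S \<noteq> {}" "S \<subseteq> Pow (L \<union> W)" "L \<subseteq> \<Inter>S" "clique S" "Q (\<Union>S) (vary S)" by blast+
    let ?T = "(\<lambda>A. A - L) ` S"
    have "L \<union> (A - L) = A" if "A \<in> S" for A using S(3) that by blast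
    then have eq: "S = (\<union>) L ` ?T" by (simp add: image_image)
    have T: "?T \<noteq> {}" "?T \<subseteq> Pow W" using S(1,2) by auto
    have "clique ?T" "Q (L \<union> \<Union>?T) (vary ?T)"
      using lift[OF T] S(4,5) unfolding eq[symmetric] by simp_all
    then show "S \<in> (`) ((\<union>) L) ` {S. S \<noteq> {} \<and> S \<subseteq> Pow W \<and> clique S \<and> Q (L \<union> \<Union>S) (vary S)}"
      using T eq by (intro image_eqI[of S _ ?T]) simp_all
  next
    fix S assume "S \<in> (`) ((\<union>) L) ` {S. S \<noteq> {} \<and> S \<subseteq> Pow W \<and> clique S \<and> Q (L \<union> \<Union>S) (vary S)}"
    then obtain T where T: "S = (\<union>) L ` T" "T \<noteq> {}" "T \<subseteq> Pow W" "clique T" "Q (L \<union> \<Union>T) (vary T)" by blast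
    then show "S \<in> {S. S \<noteq> {} \<and> S \<subseteq> Pow (L \<union> W) \<and> L \<subseteq> \<Inter>S \<and> clique S \<and> Q (\<Union>S) (vary S)}"
      using lift[OF T(2,3)] by auto
  qed
qed

lemma tower_lift:
  assumes "L \<inter> W = {}" "tower C {S. S \<noteq> {} \<and> S \<subseteq> Pow W \<and> clique S \<and> Q (L \<union> \<Union>S) (vary S)}"
  shows "tower C {S. S \<noteq> {} \<and> S \<subseteq> Pow (L \<union> W) \<and> L \<subseteq> \<Inter>S \<and> clique S \<and> Q (\<Union>S) (vary S)}"
proof -
  have "inj_on ((\<union>) L) (Pow W)" using assms(1) by (intro inj_onI) blast
  then have "inj_on ((\<union>) L) (\<Union>{S. S \<noteq> {} \<and> S \<subseteq> Pow W \<and> clique S \<and> Q (L \<union> \<Union>S) (vary S)})"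
    by (rule inj_on_subset) blast
  from tower_image[OF assms(2) this] show ?thesis unfolding lift_family[OF assms(1)] .
qed

lemma tower_face_pair:
  assumes U: "finite U" "k \<in> U" and P: "P \<subseteq> U - {k}" "card P \<le> 4"
  shows "\<exists>C\<subseteq>{5, 8}. tower C {S. S \<subseteq> Pow U \<and> clique S \<and> card (vary S) \<le> 4 \<and> \<Union>S = U \<and> vary S - {k} = P}
    \<and> (card P = 4 \<longrightarrow> C = {5, 8})"
proof -
  let ?F = "{S. S \<subseteq> Pow U \<and> clique S \<and> card (vary S) \<le> 4 \<and> \<Union>S = U \<and> vary S - {k} = P}"
  have fP: "finite P" using P(1) U(1) finite_subset by blast
  show ?thesis
  proof (cases "card P = 4")
    case False
    define W where "W = insert k P"
    define L where "L = U - W"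
    have LW: "L \<inter> W = {}" "L \<union> W = U" using P U by (auto simp: L_def W_def)
    have W: "finite W" "card W \<le> 4" "k \<in> W" "W - {k} = P"
      using P False fP by (auto simp: W_def card_insert_if)
    have F: "?F = {S. S \<noteq> {} \<and> S \<subseteq> Pow (L \<union> W) \<and> L \<subseteq> \<Inter>S \<and> clique S \<and> (\<Union>S = U \<and> vary S - {k} = P)}"
    proof (intro equalityI subsetI)
      fix S assume "S \<in> ?F"
      then have S: "S \<subseteq> Pow U" "clique S" "\<Union>S = U" "vary S - {k} = P" by blast+
      have "L \<subseteq> \<Inter>S"
      proof
        fix x assume x: "x \<in> L"
        then have "x \<notin> vary S" using S(4) by (auto simp: L_def W_def)
        then show "x \<in> \<Inter>S" using x S(3) by (auto simp: vary_def L_def)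
      qed
      moreover have "S \<noteq> {}" using S(3) U(2) by auto
      ultimately show "S \<in> {S. S \<noteq> {} \<and> S \<subseteq> Pow (L \<union> W) \<and> L \<subseteq> \<Inter>S \<and> clique S \<and> (\<Union>S = U \<and> vary S - {k} = P)}"
        using S LW(2) by simp
    next
      fix S assume "S \<in> {S. S \<noteq> {} \<and> S \<subseteq> Pow (L \<union> W) \<and> L \<subseteq> \<Inter>S \<and> clique S \<and> (\<Union>S = U \<and> vary S - {k} = P)}"
      then have S: "S \<subseteq> Pow U" "clique S" "\<Union>S = U" "vary S - {k} = P" using LW(2) by auto
      have "vary S \<subseteq> W" using S(4) by (auto simp: W_def)
      then have "card (vary S) \<le> 4" using W(1,2) card_mono le_trans by metis
      then show "S \<in> ?F" using S by simp
    qed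
    have inner: "{S. S \<noteq> {} \<and> S \<subseteq> Pow W \<and> clique S \<and> (L \<union> \<Union>S = U \<and> vary S - {k} = P)}
        = {S. S \<subseteq> Pow W \<and> clique S \<and> \<Union>S = W \<and> vary S - {k} = W - {k}}"
    proof (intro equalityI subsetI)
      fix S assume "S \<in> {S. S \<noteq> {} \<and> S \<subseteq> Pow W \<and> clique S \<and> (L \<union> \<Union>S = U \<and> vary S - {k} = P)}"
      then have S: "S \<subseteq> Pow W" "clique S" "L \<union> \<Union>S = U" "vary S - {k} = P" by blast+
      have "\<Union>S \<subseteq> W" using S(1) by blast
      moreover have "W \<subseteq> \<Union>S" using S(3) LW by blast
      ultimately show "S \<in> {S. S \<subseteq> Pow W \<and> clique S \<and> \<Union>S = W \<and> vary S - {k} = W - {k}}"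
        using S W(4) by simp
    next
      fix S assume "S \<in> {S. S \<subseteq> Pow W \<and> clique S \<and> \<Union>S = W \<and> vary S - {k} = W - {k}}"
      then have S: "S \<subseteq> Pow W" "clique S" "\<Union>S = W" "vary S - {k} = P" using W(4) by simp_all
      have "S \<noteq> {}" using S(3) W(3) by auto
      then show "S \<in> {S. S \<noteq> {} \<and> S \<subseteq> Pow W \<and> clique S \<and> (L \<union> \<Union>S = U \<and> vary S - {k} = P)}"
        using S LW(2) by simp
    qed
    have "\<exists>C\<subseteq>{5, 8}. tower C {S. S \<subseteq> Pow W \<and> clique S \<and> \<Union>S = W \<and> vary S - {k} = W - {k}}"
    proof (cases "card W \<le> 3")
      case True
      then show ?thesis using tower_small_face[OF W(1) _ W(3)] by blast
    next
      case False
      then have "card W = 4" using W(2) by simp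
      then show ?thesis using tower_half_cross_polytope[OF _ W(3)] by (meson insertI2 subset_insertI2)
    qed
    then obtain C where C: "C \<subseteq> {5, 8}"
      "tower C {S. S \<noteq> {} \<and> S \<subseteq> Pow W \<and> clique S \<and> (L \<union> \<Union>S = U \<and> vary S - {k} = P)}"
      unfolding inner by blast
    have "tower C ?F" unfolding F by (rule tower_lift[OF LW(1) C(2)])
    then show ?thesis using C(1) False by blast
  next
    case True
    define L where "L = U - P"
    have LP: "L \<inter> P = {}" "L \<union> P = U" using P U by (auto simp: L_def)
    have F: "?F = {S. S \<noteq> {} \<and> S \<subseteq> Pow (L \<union> P) \<and> L \<subseteq> \<Inter>S \<and> clique S \<and> (\<Union>S = U \<and> vary S = P)}"
    proof (intro equalityI subsetI)
      fix S assume "S \<in> ?F"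
      then have S: "S \<subseteq> Pow U" "clique S" "\<Union>S = U" "vary S - {k} = P" "card (vary S) \<le> 4" by blast+
      have "finite (vary S)" using S(3) U(1) by (simp add: vary_def)
      moreover have "P \<subseteq> vary S" using S(4) by blast
      ultimately have vP: "vary S = P" using S(5) True by (intro card_seteq[symmetric]) auto
      have "L \<subseteq> \<Inter>S"
      proof
        fix x assume x: "x \<in> L"
        then have "x \<notin> vary S" using vP by (auto simp: L_def)
        then show "x \<in> \<Inter>S" using x S(3) by (auto simp: vary_def L_def)
      qed
      moreover have "S \<noteq> {}" using S(3) U(2) by auto
      ultimately show "S \<in> {S. S \<noteq> {} \<and> S \<subseteq> Pow (L \<union> P) \<and> L \<subseteq> \<Inter>S \<and> clique S \<and> (\<Union>S = U \<and> vary S = P)}"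
        using S vP LP(2) by simp
    next
      fix S assume "S \<in> {S. S \<noteq> {} \<and> S \<subseteq> Pow (L \<union> P) \<and> L \<subseteq> \<Inter>S \<and> clique S \<and> (\<Union>S = U \<and> vary S = P)}"
      then have S: "S \<subseteq> Pow U" "clique S" "\<Union>S = U" "vary S = P" using LP(2) by auto
      moreover have "P - {k} = P" using P(1) by blast
      ultimately show "S \<in> ?F" using True by simp
    qed
    have inner: "{S. S \<noteq> {} \<and> S \<subseteq> Pow P \<and> clique S \<and> (L \<union> \<Union>S = U \<and> vary S = P)}
        = {S. S \<subseteq> Pow P \<and> clique S \<and> vary S = P}"
    proof -
      have "S \<noteq> {} \<and> L \<union> \<Union>S = U" if S: "S \<subseteq> Pow P" "vary S = P" for S
      proof -
        have "P \<noteq> {}" using True by auto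
        then have "S \<noteq> {}" using S(2) by (auto simp: vary_def)
        moreover have "\<Union>S = P" using S by (auto simp: vary_def)
        ultimately show ?thesis using LP(2) by simp
      qed
      then show ?thesis by blast
    qed
    have C: "tower {5, 8} {S. S \<noteq> {} \<and> S \<subseteq> Pow P \<and> clique S \<and> (L \<union> \<Union>S = U \<and> vary S = P)}"
      unfolding inner by (rule tower_cross_polytope[OF True])
    have "tower {5, 8} ?F" unfolding F by (rule tower_lift[OF LP(1) C])
    then show ?thesis by blast
  qed
qed

definition narrow :: "'a set \<Rightarrow> 'a set set set" where
  "narrow N = {S. S \<subseteq> Pow N \<and> clique S \<and> card (vary S) \<le> 4}"

lemma tower_fibres_bounded:
  fixes \<phi> :: "'a set \<Rightarrow> 'b::order"
  assumes fin: "finite F" and mono: "\<And>S T. S \<in> F \<Longrightarrow> T \<in> F \<Longrightarrow> S \<subseteq> T \<Longrightarrow> \<phi> S \<le> \<phi> T"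
    and fib: "\<And>b. b \<in> \<phi> ` F \<Longrightarrow> \<exists>C\<subseteq>M. tower C {S\<in>F. \<phi> S = b}"
    and full: "P \<Longrightarrow> tower M {S\<in>F. \<phi> S = b0}" "M \<noteq> {}"
  shows "\<exists>C\<subseteq>M. tower C F \<and> (P \<longrightarrow> C = M)"
proof -
  obtain c where c: "\<And>b. b \<in> \<phi> ` F \<Longrightarrow> c b \<subseteq> M \<and> tower (c b) {S\<in>F. \<phi> S = b}"
    using fib by metis
  define c' where "c' b = (if P \<and> b = b0 then M else c b)" for b
  have "tower (c' b) {S\<in>F. \<phi> S = b}" if "b \<in> \<phi> ` F" for b
    using c[OF that] full by (auto simp: c'_def)
  with fin mono have T: "tower (\<Union>b\<in>\<phi> ` F. c' b) F" by (rule tower_fibres)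
  have "(\<Union>b\<in>\<phi> ` F. c' b) \<subseteq> M"
  proof (rule UN_least)
    fix b assume "b \<in> \<phi> ` F"
    then show "c' b \<subseteq> M" using c[of b] by (cases "P \<and> b = b0") (simp_all add: c'_def)
  qed
  moreover have "M \<subseteq> (\<Union>b\<in>\<phi> ` F. c' b)" if P
  proof -
    have "{S\<in>F. \<phi> S = b0} \<noteq> {}"
    proof
      assume "{S\<in>F. \<phi> S = b0} = {}"
      then have "tower M ({} :: 'a set set)" using full(1)[OF that] by (simp only:)
      then show False using full(2) by (cases rule: tower.cases) auto
    qed
    then have "b0 \<in> \<phi> ` F" by blast
    moreover have "c' b0 = M" using that by (simp add: c'_def)
    ultimately show ?thesis by blast
  qed
  ultimately show ?thesis using T by blast
qed

lemma tower_union_fibre: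
  fixes N :: "nat set"
  assumes N: "finite N" and U: "U \<subseteq> N"
  shows "\<exists>C\<subseteq>{5, 8}. tower C {S \<in> narrow N. \<Union>S = U} \<and> (5 \<le> card U \<longrightarrow> C = {5, 8})"
proof (cases "U = {}")
  case True
  have "tower {} {S \<in> narrow N. \<Union>S = U}"
  proof (rule tower_toggle[of _ "{}"])
    have "finite (Pow (Pow N))" using N by simp
    then show "finite {S \<in> narrow N. \<Union>S = U}"
      by (rule finite_subset[rotated]) (auto simp: narrow_def)
  next
    fix S assume "S \<in> {S \<in> narrow N. \<Union>S = U}"
    then have "S \<subseteq> {{}}" using True by auto
    then have "insert {} S \<subseteq> {{}}" "S - {{}} \<subseteq> {{}}" by blast+
    moreover have "T \<in> {S \<in> narrow N. \<Union>S = U}" if "T \<subseteq> {{}}" for T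
    proof -
      have "T = {} \<or> T = {{}}" using that by blast
      then show ?thesis using True by (auto simp: narrow_def clique_def vary_def)
    qed
    ultimately show "insert {} S \<in> {S \<in> narrow N. \<Union>S = U}" "S - {{}} \<in> {S \<in> narrow N. \<Union>S = U}"
      by blast+
  qed
  then show ?thesis using True by (intro exI[of _ "{}"]) simp
next
  case False
  define k where "k = Min U"
  have fU: "finite U" using N U finite_subset by blast
  have k: "k \<in> U" using Min_in[OF fU False] by (simp add: k_def)
  let ?F = "{S \<in> narrow N. \<Union>S = U}"
  have fin: "finite ?F"
  proof (rule finite_subset[of _ "Pow (Pow N)"])
    show "finite (Pow (Pow N))" using N by simp
  qed (auto simp: narrow_def)
  have fib: "{S \<in> ?F. vary S - {k} = P}
      = {S. S \<subseteq> Pow U \<and> clique S \<and> card (vary S) \<le> 4 \<and> \<Union>S = U \<and> vary S - {k} = P}" for P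
  proof -
    have "S \<subseteq> Pow N \<longleftrightarrow> S \<subseteq> Pow U" if "\<Union>S = U" for S using that U by auto
    then show ?thesis unfolding narrow_def by blast
  qed
  have P: "P \<subseteq> U - {k} \<and> card P \<le> 4" if P: "P \<in> (\<lambda>S. vary S - {k}) ` ?F" for P
  proof -
    obtain S where S: "S \<in> narrow N" "\<Union>S = U" "P = vary S - {k}" using P by blast
    have "vary S \<subseteq> U" using S(2) by (auto simp: vary_def)
    then have "card P \<le> card (vary S)" unfolding S(3) using fU finite_subset by (intro card_mono) blast+
    then show ?thesis using S \<open>vary S \<subseteq> U\<close> by (auto simp: narrow_def)
  qed
  have "card (U - {k}) \<ge> 4" if "5 \<le> card U" using that k fU by simp
  then obtain P0 where P0: "5 \<le> card U \<Longrightarrow> P0 \<subseteq> U - {k} \<and> card P0 = 4"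
    by (metis obtain_subset_with_card_n)
  show ?thesis
  proof (rule tower_fibres_bounded[where \<phi> = "\<lambda>S. vary S - {k}" and ?b0.0 = P0, OF fin])
    show "vary S - {k} \<subseteq> vary T - {k}" if "S \<subseteq> T" for S T :: "nat set set"
      using vary_mono[OF that] by blast
    show "\<exists>C\<subseteq>{5, 8}. tower C {S \<in> ?F. vary S - {k} = b}" if "b \<in> (\<lambda>S. vary S - {k}) ` ?F" for b
      unfolding fib using tower_face_pair[OF fU k] P[OF that] by blast
    show "tower {5, 8} {S \<in> ?F. vary S - {k} = P0}" if "5 \<le> card U"
      unfolding fib using tower_face_pair[OF fU k, of P0] P0[OF that] by auto
  qed simp
qed

lemma tower_narrow:
  fixes N :: "nat set"
  assumes N: "finite N" "5 \<le> card N"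
  shows "tower {5, 8} (narrow N)"
proof -
  have "\<exists>C\<subseteq>{5, 8}. tower C (narrow N) \<and> (True \<longrightarrow> C = {5, 8})"
  proof (rule tower_fibres_bounded[where \<phi> = Union and ?b0.0 = N])
    show "finite (narrow N)"
      by (rule finite_subset[of _ "Pow (Pow N)"]) (use N(1) in \<open>auto simp: narrow_def\<close>)
    show "\<Union>S \<subseteq> \<Union>T" if "S \<subseteq> T" for S T :: "nat set set" using that by blast
    show "\<exists>C\<subseteq>{5, 8}. tower C {S \<in> narrow N. \<Union>S = U}" if "U \<in> Union ` narrow N" for U
    proof -
      have "U \<subseteq> N" using that by (auto simp: narrow_def)
      then show ?thesis using tower_union_fibre[OF N(1)] by blast
    qed
    show "tower {5, 8} {S \<in> narrow N. \<Union>S = N}"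
      using tower_union_fibre[OF N(1) subset_refl] N(2) by auto
  qed simp
  then show ?thesis by auto
qed

lemma tower_cliques:
  fixes N :: "nat set"
  assumes N: "finite N" "5 \<le> card N"
  shows "tower {5, 8} {S. S \<subseteq> Pow N \<and> clique S}"
proof -
  have "tower ({5, 8} \<union> {}) (narrow N \<union> wide N)"
  proof (rule tower_append[OF tower_wide[OF N(1)] tower_narrow[OF N]])
    fix S S' assume S: "S \<in> wide N" "S' \<in> narrow N"
    show "\<not> S \<subseteq> S'"
    proof
      assume "S \<subseteq> S'"
      then have "vary S \<subseteq> vary S'" by (rule vary_mono)
      moreover have "vary S' \<subseteq> N" using S(2) by (auto simp: narrow_def vary_def)
      ultimately have "card (vary S) \<le> card (vary S')" using N(1) finite_subset by (metis card_mono)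
      then show False using S by (simp add: wide_def narrow_def)
    qed
  qed
  moreover have "narrow N \<union> wide N = {S. S \<subseteq> Pow N \<and> clique S}"
    by (auto simp: narrow_def wide_def)
  ultimately show ?thesis by simp
qed

section \<open>The Vietoris-Rips complex of the hypercube\<close>

definition list_of_set :: "nat \<Rightarrow> nat set \<Rightarrow> bool list" where
  "list_of_set n A = map (\<lambda>i. i \<in> A) [0..<n]"

lemma hamming_list_of_set:
  assumes "A \<subseteq> {..<n}" "B \<subseteq> {..<n}"
  shows "hamming (list_of_set n A) (list_of_set n B) = real (card (sdiff A B))"
proof -
  have "{i. i < n \<and> list_of_set n A ! i \<noteq> list_of_set n B ! i} = sdiff A B"
    using assms by (auto simp: list_of_set_def sdiff_def)
  then show ?thesis by (simp add: hamming_def list_of_set_def)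
qed

lemma bij_betw_list_of_set: "bij_betw (list_of_set n) (Pow {..<n}) (hypercube n)"
proof (rule bij_betw_byWitness[where f' = "\<lambda>v. {i. i < n \<and> v ! i}"])
  show "\<forall>v\<in>hypercube n. list_of_set n {i. i < n \<and> v ! i} = v"
    by (auto simp: list_of_set_def hypercube_def intro!: nth_equalityI)
qed (auto simp: list_of_set_def hypercube_def)

lemma vr_complex_hypercube_eq:
  "vr_complex (hypercube n) hamming 3 = (`) (list_of_set n) ` {S. S \<subseteq> Pow {..<n} \<and> clique S}"
proof -
  let ?f = "list_of_set n"
  have img: "?f ` Pow {..<n} = hypercube n" using bij_betw_list_of_set by (rule bij_betw_imp_surj_on)
  have cl: "clique S \<longleftrightarrow> (\<forall>v\<in>?f ` S. \<forall>w\<in>?f ` S. hamming v w \<le> 3)" if S: "S \<subseteq> Pow {..<n}" for S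
  proof -
    have "hamming (?f A) (?f B) \<le> 3 \<longleftrightarrow> card (sdiff A B) \<le> 3" if "A \<in> S" "B \<in> S" for A B
    proof -
      have "A \<subseteq> {..<n}" "B \<subseteq> {..<n}" using that S by blast+
      then show ?thesis by (simp add: hamming_list_of_set)
    qed
    then show ?thesis by (simp add: clique_def)
  qed
  show ?thesis
  proof (intro equalityI subsetI)
    fix K assume "K \<in> vr_complex (hypercube n) hamming 3"
    then have K: "K \<subseteq> ?f ` Pow {..<n}" "\<forall>v\<in>K. \<forall>w\<in>K. hamming v w \<le> 3"
      by (auto simp: vr_complex_def img)
    obtain S where S: "S \<subseteq> Pow {..<n}" "K = ?f ` S" using K(1) by (auto simp: subset_image_iff)
    then show "K \<in> (`) ?f ` {S. S \<subseteq> Pow {..<n} \<and> clique S}" using cl[OF S(1)] K(2) by blast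
  next
    fix K assume "K \<in> (`) ?f ` {S. S \<subseteq> Pow {..<n} \<and> clique S}"
    then obtain S where S: "S \<subseteq> Pow {..<n}" "clique S" "K = ?f ` S" by blast
    have "finite S" using S(1) by (rule finite_subset) simp
    moreover have "K \<subseteq> hypercube n" using S(1,3) img by blast
    ultimately show "K \<in> vr_complex (hypercube n) hamming 3"
      using cl[OF S(1)] S(2,3) by (simp add: vr_complex_def)
  qed
qed

theorem theorem1p2:
  fixes n :: nat and i :: int
  assumes "n \<ge> 5"
  shows "carrier (reduced_homology (vr_complex (hypercube n) hamming 3) i)
           \<noteq> {\<one>\<^bsub>reduced_homology (vr_complex (hypercube n) hamming 3) i\<^esub>}
         \<longleftrightarrow> i \<in> {4, 7}"
proof -
  let ?K = "vr_complex (hypercube n) hamming 3"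
  have "inj_on (list_of_set n) (\<Union>{S. S \<subseteq> Pow {..<n} \<and> clique S})"
    by (rule inj_on_subset[OF bij_betw_imp_inj_on[OF bij_betw_list_of_set[of n]]]) blast
  then have tower: "tower {5, 8} ?K"
    unfolding vr_complex_hypercube_eq using assms by (intro tower_image tower_cliques) simp_all
  have down: "T \<in> ?K" if "S \<in> ?K" "T \<subseteq> S" for S T
    using that by (auto simp: vr_complex_def intro: finite_subset)
  have sub: "?K \<subseteq> Pow (hypercube n)" by (auto simp: vr_complex_def)
  have fin: "finite (hypercube n)"
    using bij_betw_finite[OF bij_betw_list_of_set[of n]] by simp
  have "exact_at (hypercube n) ?K i \<longleftrightarrow> i + 1 \<notin> int ` {5, 8}"
    by (rule tower_exact_at[OF tower down sub fin]) auto
  moreover have "i + 1 \<in> int ` {5, 8} \<longleftrightarrow> i \<in> {4, 7}" by auto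
  moreover have "carrier (reduced_homology ?K i) \<noteq> {\<one>\<^bsub>reduced_homology ?K i\<^esub>} \<longleftrightarrow> \<not> exact_at (hypercube n) ?K i"
    by (rule reduced_homology_nontrivial_iff[OF down sub fin])
  ultimately show ?thesis by (simp only: not_not)
qed

end
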